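(* Let $p\in[2,\infty]$, $\frac1p+\frac1q=1$, $\delta>0$, let $\|\cdot\|$ be the Euclidean norm on $\mathbb{R}^d$, and let $\mu_0,f,\Phi,\ell,\Theta_0,\Theta,j,J$ be as in the context, satisfying the assumptions listed there. Then the problem $$\min_{\theta\in\Theta}\left\{J(\mu_0,\theta)+\delta\left(\mathbb{E}_{x\sim\mu_0}\left[\|\nabla_xj(x,\theta)\|^q\right]\right)^{1/q}+\frac{\delta^2}{2}\left(\mathbb{E}_{x\sim\mu_0}\left[\|\nabla_xj(x,\theta)\|^q\right]\right)^{-2/p}\mathbb{E}_{x\sim\mu_0}\left[\frac{\nabla_xj^\top D_x^2j\,\nabla_xj}{\|\nabla_xj\|^{2(1-1/(p-1))}}(x,\theta)\right]\right\}$$ can be rewritten as $$\inf_{\theta\in\Theta}\left\{\mathbb{E}_{x\sim\mu_0}[\ell(X_{x,T},\theta_T)]+\delta\left(\mathbb{E}_{x\sim\mu_0}[\|P_{x,0}\|^q]\right)^{1/q}+\frac{\delta}{2}\,\frac{\mathbb{E}_{x\sim\mu_0}\left[\|P_{x,0}\|^{q-2}\,\hat\alpha_{x,0}\cdot P_{x,0}\right]}{\left(\mathbb{E}_{x\sim\mu_0}[\|P_{x,0}\|^q]\right)^{1/p}}\right\}$$ subject to $$\begin{cases}\dot X_{x,t}=f(X_{x,t},\theta_t),\quad X_{x,0}=x,\\[2pt]\dot P_{x,t}=-D_\xi f(X_{x,t},\theta_t)^\top P_{x,t}+\nabla_\xi\Phi(X_{x,t},\theta_t),\quad P_{x,T}=-\nabla_\xi\ell(X_{x,T},\theta_T),\\[2pt]\dot\beta_{x,t}=D_\xi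 f(X_{x,t},\theta_t)\beta_{x,t},\quad\beta_{x,0}=\delta\left(\mathbb{E}_{x_0\sim\mu_0}[\|P_{x_0,0}\|^q]\right)^{-1/p}\|P_{x,0}\|^{q-2}P_{x,0},\\[2pt]\dot{\hat\alpha}_{x,t}=-D_\xi f(X_{x,t},\theta_t)^\top\hat\alpha_{x,t}+\left\{D^2_\xi f(X_{x,t},\theta_t)^\top P_{x,t}\right\}^\top\beta_{x,t},\quad\hat\alpha_{x,T}=D^2_\xi\ell(X_{x,T},\theta_T)^\top\beta_{x,T}.\end{cases}$$
   Context: Setting. Fix $T>0$, a parameter set $\Theta_0$, and functions $f:\mathbb{R}^d\times\Theta_0\to\mathbb{R}^d$, $\Phi:\mathbb{R}^d\times\Theta_0\to\mathbb{R}$ (running cost), $\ell:\mathbb{R}^d\times\Theta_0\to\mathbb{R}$ (terminal cost), whose variables are written $(\xi,\vartheta)$. $\Theta$ is a given family of controls $\theta:[0,T]\to\Theta_0$. For $\theta\in\Theta$, $x\in\mathbb{R}^d$, with $X_{x,\cdot}$ the solution of $\dot X_{x,t}=f(X_{x,t},\theta_t)$, $X_{x,0}=x$, the loss is $j(x,\theta)=\ell(X_{x,T},\theta_T)+\int_0^T\Phi(X_{x,t},\theta_t)\,dt$, and $J(\mu_0,\theta)=\mathbb{E}_{x\sim\mu_0}[j(x,\theta)]$. Assumptions. $f$ is bounded; $f,\Phi$ are continuous in $\vartheta$; $f,\Phi,\ell$ are twice continuously differentiable in $\xi$, with first derivatives in $\xi$ Lipschitz continuous in $\xi$ uniformly in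 $\vartheta$; $\ell$ is continuously differentiable in $\vartheta$; $\mu_0$ is a probability measure on $\mathbb{R}^d$ with bounded support. Notation. $[D_\xi f]_{ij}=\partial f_i/\partial\xi_j$. For $P\in\mathbb{R}^d$, $D^2_\xi f^\top P$ is the $d\times d$ matrix with entries $\sum_kP_k\,\partial^2f_k/\partial\xi_i\partial\xi_j$. $D^2_\xi\ell$ is the Hessian in $\xi$. For $p=\infty$: $q=1$ and $1/p=2/p=1/(p-1)=0$. Expressions of the form $0/0$ are read as $0$.
   Formalization: The printed reformulation fails for general Φ (f=0, ℓ=0, Φ=1 gives T versus 0); the formal version adds E[∫₀ᵀΦ(X_{x,t},θ_t)dt] to the second objective and the term −D²_ξΦ(X_{x,t},θ_t)β_{x,t} to the equation for α̂; for Φ=0 it is the printed statement. *)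

theory Defs
  imports "HOL-Probability.Probability"
begin

section \<open>Derivatives in the state variable\<close>

definition grad :: "(real^'d \<Rightarrow> real) \<Rightarrow> real^'d \<Rightarrow> real^'d" where
  "grad g x = (\<chi> i. frechet_derivative g (at x) (axis i 1))"

definition hess :: "(real^'d \<Rightarrow> real) \<Rightarrow> real^'d \<Rightarrow> real^'d^'d" where
  "hess g x = jacobian (grad g) (at x)"

definition twice_differentiable :: "(real^'d \<Rightarrow> real) \<Rightarrow> bool" where
  "twice_differentiable g \<longleftrightarrow>
     (\<forall>x. g differentiable (at x)) \<and> (\<forall>x. grad g differentiable (at x))"

definition C2 :: "(real^'d \<Rightarrow> real) \<Rightarrow> bool" where
  "C2 g \<longleftrightarrow> twice_differentiable g \<and> continuous_on UNIV (hess g)"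

definition D2_transpose :: "(real^'d \<Rightarrow> real^'d) \<Rightarrow> real^'d \<Rightarrow> real^'d \<Rightarrow> real^'d^'d" where
  "D2_transpose F x P = (\<chi> i j. \<Sum>k\<in>UNIV. P $ k * hess (\<lambda>y. F y $ k) x $ i $ j)"

definition continuously_differentiable_on :: "('c::real_normed_vector \<Rightarrow> real) \<Rightarrow> 'c set \<Rightarrow> bool" where
  "continuously_differentiable_on g S \<longleftrightarrow>
     (\<exists>g' :: 'c \<Rightarrow> 'c \<Rightarrow>\<^sub>L real. continuous_on S g' \<and>
        (\<forall>v\<in>S. (g has_derivative blinfun_apply (g' v)) (at v within S)))"

section \<open>Powers and measures\<close>

text \<open>In the library \<open>0 powr 0 = 0\<close>; here \<open>0\<close> to the power \<open>0\<close> is \<open>1\<close>, while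
  \<open>0\<close> to any other power stays \<open>0\<close>. Together with \<open>x / 0 = 0\<close> this reads \<open>0 / 0\<close> as \<open>0\<close>,
  also when the denominator is written as a negative power.\<close>

definition rpow :: "real \<Rightarrow> real \<Rightarrow> real" where
  "rpow a b = (if b = 0 then 1 else a powr b)"

definition measure_support :: "'a::topological_space measure \<Rightarrow> 'a set" where
  "measure_support M = {x. \<forall>U. open U \<longrightarrow> x \<in> U \<longrightarrow> emeasure M U > 0}"

section \<open>Controlled trajectories and the loss\<close>

text \<open>Controls need not be continuous in time, so \<open>y' = F t y\<close> on \<open>[0,T]\<close> is understood in the
  sense of Caratheodory, i.e. through its integral form. Wherever the right-hand side is continuous
  in time along \<open>y\<close>, this is the classical derivative.\<close>

definition solves_ode :: "real \<Rightarrow> (real \<Rightarrow> real^'d \<Rightarrow> real^'d) \<Rightarrow> (real \<Rightarrow> real^'d) \<Rightarrow> bool" where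
  "solves_ode T F y \<longleftrightarrow>
     (\<lambda>s. F s (y s)) absolutely_integrable_on {0..T} \<and>
     (\<forall>t\<in>{0..T}. y t = y 0 + integral {0..t} (\<lambda>s. F s (y s)))"

text \<open>What is needed of a control for the state equation and the loss to make sense. Since the
  state gradient of \<open>\<Phi>\<close> is Lipschitz uniformly in the parameter, integrability of the running cost
  at every frozen state amounts to its integrability along all trajectories, i.e. to the existence
  of the integral in the loss. It holds for instance if \<open>\<theta>\<close> is continuous.\<close>

definition admissible_control ::
  "real \<Rightarrow> 'c::real_normed_vector set \<Rightarrow> (real^'d \<Rightarrow> 'c \<Rightarrow> real) \<Rightarrow> (real \<Rightarrow> 'c) \<Rightarrow> bool" where
  "admissible_control T \<Theta>\<^sub>0 \<Phi> \<theta> \<longleftrightarrow>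
     (\<forall>t\<in>{0..T}. \<theta> t \<in> \<Theta>\<^sub>0) \<and>
     \<theta> \<in> borel_measurable (lebesgue_on {0..T}) \<and>
     (\<forall>\<xi>. (\<lambda>t. \<Phi> \<xi> (\<theta> t)) absolutely_integrable_on {0..T})"

text \<open>For admissible controls, and \<open>f\<close> as in the theorem, the trajectory is unique on \<open>[0,T]\<close>; its
  values outside \<open>[0,T]\<close> are arbitrary and never used.\<close>

definition trajectory ::
  "real \<Rightarrow> (real^'d \<Rightarrow> 'c \<Rightarrow> real^'d) \<Rightarrow> (real \<Rightarrow> 'c) \<Rightarrow> real^'d \<Rightarrow> real \<Rightarrow> real^'d" where
  "trajectory T f \<theta> x = (SOME X. solves_ode T (\<lambda>t y. f y (\<theta> t)) X \<and> X 0 = x)"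

definition loss ::
  "real \<Rightarrow> (real^'d \<Rightarrow> 'c \<Rightarrow> real^'d) \<Rightarrow> (real^'d \<Rightarrow> 'c \<Rightarrow> real) \<Rightarrow> (real^'d \<Rightarrow> 'c \<Rightarrow> real) \<Rightarrow>
   real^'d \<Rightarrow> (real \<Rightarrow> 'c) \<Rightarrow> real" where
  "loss T f \<Phi> l x \<theta> =
     l (trajectory T f \<theta> x T) (\<theta> T) + integral {0..T} (\<lambda>t. \<Phi> (trajectory T f \<theta> x t) (\<theta> t))"

definition expected_loss ::
  "real \<Rightarrow> (real^'d \<Rightarrow> 'c \<Rightarrow> real^'d) \<Rightarrow> (real^'d \<Rightarrow> 'c \<Rightarrow> real) \<Rightarrow> (real^'d \<Rightarrow> 'c \<Rightarrow> real) \<Rightarrow>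
   (real^'d) measure \<Rightarrow> (real \<Rightarrow> 'c) \<Rightarrow> real" where
  "expected_loss T f \<Phi> l \<mu>\<^sub>0 \<theta> = (\<integral>x. loss T f \<Phi> l x \<theta> \<partial>\<mu>\<^sub>0)"

section \<open>The two optimisation problems\<close>

text \<open>The exponent \<open>p\<close> is an extended real, so that \<open>1 / p = 2 / p = 1 / (p - 1) = 0\<close> for
  \<open>p = \<infinity>\<close> is ordinary \<open>ereal\<close> arithmetic.\<close>

definition robust_objective ::
  "real \<Rightarrow> (real^'d \<Rightarrow> 'c \<Rightarrow> real^'d) \<Rightarrow> (real^'d \<Rightarrow> 'c \<Rightarrow> real) \<Rightarrow> (real^'d \<Rightarrow> 'c \<Rightarrow> real) \<Rightarrow>
   (real^'d) measure \<Rightarrow> ereal \<Rightarrow> real \<Rightarrow> real \<Rightarrow> (real \<Rightarrow> 'c) \<Rightarrow> real" where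
  "robust_objective T f \<Phi> l \<mu>\<^sub>0 p q \<delta> \<theta> =
     (let j = (\<lambda>x. loss T f \<Phi> l x \<theta>);
          E = (\<integral>x. rpow (norm (grad j x)) q \<partial>\<mu>\<^sub>0)
      in expected_loss T f \<Phi> l \<mu>\<^sub>0 \<theta>
         + \<delta> * rpow E (1 / q)
         + \<delta>\<^sup>2 / 2 * rpow E (- real_of_ereal (2 / p))
           * (\<integral>x. (grad j x \<bullet> (hess j x *v grad j x))
                  / rpow (norm (grad j x)) (2 * (1 - real_of_ereal (1 / (p - 1)))) \<partial>\<mu>\<^sub>0))"

text \<open>The running cost enters the adjoint problem in two places besides the equation for \<open>P\<close>:
  through its integral in \<open>adjoint_objective\<close> and through its Hessian in the equation for \<open>\<alpha>\<close> in
  \<open>adjoint_system\<close>. Both terms are missing in the published formulation of this problem, which is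
  the case \<open>\<Phi> = 0\<close> of the present one and is not equivalent to the original problem for general
  \<open>\<Phi>\<close> (take \<open>f = 0\<close> and \<open>l = 0\<close>).\<close>

definition adjoint_system ::
  "real \<Rightarrow> (real^'d \<Rightarrow> 'c \<Rightarrow> real^'d) \<Rightarrow> (real^'d \<Rightarrow> 'c \<Rightarrow> real) \<Rightarrow> (real^'d \<Rightarrow> 'c \<Rightarrow> real) \<Rightarrow>
   (real^'d) measure \<Rightarrow> ereal \<Rightarrow> real \<Rightarrow> real \<Rightarrow> (real \<Rightarrow> 'c) \<Rightarrow>
   (real^'d \<Rightarrow> real \<Rightarrow> real^'d) \<Rightarrow> (real^'d \<Rightarrow> real \<Rightarrow> real^'d) \<Rightarrow>
   (real^'d \<Rightarrow> real \<Rightarrow> real^'d) \<Rightarrow> (real^'d \<Rightarrow> real \<Rightarrow> real^'d) \<Rightarrow> bool" where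
  "adjoint_system T f \<Phi> l \<mu>\<^sub>0 p q \<delta> \<theta> X P \<beta> \<alpha> \<longleftrightarrow>
     (\<forall>x.
       (solves_ode T (\<lambda>t y. f y (\<theta> t)) (X x) \<and> X x 0 = x) \<and>
       (solves_ode T
          (\<lambda>t y. - (transpose (jacobian (\<lambda>\<xi>. f \<xi> (\<theta> t)) (at (X x t))) *v y)
                 + grad (\<lambda>\<xi>. \<Phi> \<xi> (\<theta> t)) (X x t)) (P x) \<and>
        P x T = - grad (\<lambda>\<xi>. l \<xi> (\<theta> T)) (X x T)) \<and>
       (solves_ode T
          (\<lambda>t y. jacobian (\<lambda>\<xi>. f \<xi> (\<theta> t)) (at (X x t)) *v y) (\<beta> x) \<and>
        \<beta> x 0 = (\<delta> * rpow (\<integral>x\<^sub>0. rpow (norm (P x\<^sub>0 0)) q \<partial>\<mu>\<^sub>0) (- real_of_ereal (1 / p))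
                 * rpow (norm (P x 0)) (q - 2)) *\<^sub>R P x 0) \<and>
       (solves_ode T
          (\<lambda>t y. - (transpose (jacobian (\<lambda>\<xi>. f \<xi> (\<theta> t)) (at (X x t))) *v y)
                 + transpose (D2_transpose (\<lambda>\<xi>. f \<xi> (\<theta> t)) (X x t) (P x t)
                              - hess (\<lambda>\<xi>. \<Phi> \<xi> (\<theta> t)) (X x t)) *v \<beta> x t) (\<alpha> x) \<and>
        \<alpha> x T = transpose (hess (\<lambda>\<xi>. l \<xi> (\<theta> T)) (X x T)) *v \<beta> x T))"

definition adjoint_objective ::
  "real \<Rightarrow> (real^'d \<Rightarrow> 'c \<Rightarrow> real) \<Rightarrow> (real^'d \<Rightarrow> 'c \<Rightarrow> real) \<Rightarrow>
   (real^'d) measure \<Rightarrow> ereal \<Rightarrow> real \<Rightarrow> real \<Rightarrow> (real \<Rightarrow> 'c) \<Rightarrow>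
   (real^'d \<Rightarrow> real \<Rightarrow> real^'d) \<Rightarrow> (real^'d \<Rightarrow> real \<Rightarrow> real^'d) \<Rightarrow>
   (real^'d \<Rightarrow> real \<Rightarrow> real^'d) \<Rightarrow> real" where
  "adjoint_objective T \<Phi> l \<mu>\<^sub>0 p q \<delta> \<theta> X P \<alpha> =
     (let E = (\<integral>x. rpow (norm (P x 0)) q \<partial>\<mu>\<^sub>0)
      in (\<integral>x. l (X x T) (\<theta> T) + integral {0..T} (\<lambda>t. \<Phi> (X x t) (\<theta> t)) \<partial>\<mu>\<^sub>0)
         + \<delta> * rpow E (1 / q)
         + \<delta> / 2 * ((\<integral>x. rpow (norm (P x 0)) (q - 2) * (\<alpha> x 0 \<bullet> P x 0) \<partial>\<mu>\<^sub>0)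
                    / rpow E (real_of_ereal (1 / p))))"

end

theory Submission
  imports Defs
begin

text \<open>Differentiating the state equation in the initial value shows that the costate satisfies
  \<open>P\<^bsub>x,0\<^esub> = - \<nabla>j(x)\<close>: along a solution \<open>\<beta>\<close> of the linearised state equation the derivative of \<open>P \<bullet> \<beta>\<close> is
  \<open>\<nabla>\<Phi> \<bullet> \<beta>\<close>. Differentiating the costate equation once more, in the direction \<open>\<beta>\<close>, gives the equation of
  \<open>- \<alpha>\<close>, whence \<open>\<alpha>\<^bsub>x,0\<^esub> = D\<^sup>2j(x) \<beta>\<^bsub>x,0\<^esub>\<close>. With the given \<open>\<beta>\<^bsub>x,0\<^esub>\<close> the two objectives agree by the
  exponent identity \<open>2(q - 2) = - 2(1 - 1/(p - 1))\<close>. All equations are Lipschitz in the unknown with a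
  constant independent of time, as boundedness of \<open>f\<close> and the Lipschitz condition on its derivative
  bound the derivative.\<close>

section \<open>Absolutely continuous functions on a time interval\<close>

text \<open>Controls are merely measurable in time, so no equation here need hold pointwise:
  existence, uniqueness, stability and differentiability are drawn from integral forms, the
  estimates all coming from one Gronwall bound, run forward for the state and \<beta>, backward for
  P and \<alpha>. The two differentiations differ in strength. The state gradients are Lipschitz, so
  the flow and the cost have quadratic remainders. The Hessians are only continuous, with no modulus
  uniform in time, so the costate has a remainder of order o(norm (y - x)) only: it is found at each
  time separately and then integrated by dominated convergence, the Lipschitz constants of the
  gradients supplying the majorant. Measurability in time of the state derivatives is inherited from
  the functions through difference quotients. Solutions are arbitrary outside the time interval, so
  a given solution of the adjoint system is compared with the chosen one on \<open>{0..T}\<close>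
  alone.\<close>

definition primitive_on :: "real \<Rightarrow> (real \<Rightarrow> 'a::euclidean_space) \<Rightarrow> (real \<Rightarrow> 'a) \<Rightarrow> bool" where
  "primitive_on T u y \<longleftrightarrow>
     u absolutely_integrable_on {0..T} \<and> (\<forall>t\<in>{0..T}. y t = y 0 + integral {0..t} u)"

text \<open>Freezing the right-hand side along the solution as a density \<open>u\<close> lets
  solutions of different equations be added, scaled, subtracted and reversed without leaving the
  format.\<close>

lemma solves_ode_iff_primitive: "solves_ode T F y \<longleftrightarrow> primitive_on T (\<lambda>s. F s (y s)) y"
  by (simp add: solves_ode_def primitive_on_def)

lemma primitive_on_abs: "primitive_on T u y \<Longrightarrow> u absolutely_integrable_on {0..T}"
  unfolding primitive_on_def by blast

lemma primitive_on_integrable: "primitive_on T u y \<Longrightarrow> u integrable_on {0..T}"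
  using primitive_on_abs absolutely_integrable_on_def by blast

lemma primitive_on_eq:
  "primitive_on T u y \<Longrightarrow> t \<in> {0..T} \<Longrightarrow> y t = y 0 + integral {0..t} u"
  unfolding primitive_on_def by blast

lemma primitive_on_diff_eq:
  assumes "primitive_on T u y" "0 \<le> a" "a \<le> b" "b \<le> T"
  shows "y b - y a = integral {a..b} u"
proof -
  have "u integrable_on {0..b}"
    using assms by (intro integrable_on_subinterval[OF primitive_on_integrable[OF assms(1)]]) auto
  then have "integral {0..a} u + integral {a..b} u = integral {0..b} u"
    using assms by (intro Henstock_Kurzweil_Integration.integral_combine) auto
  moreover have "y a = y 0 + integral {0..a} u" "y b = y 0 + integral {0..b} u"
    using assms by (auto intro!: primitive_on_eq[OF assms(1)])
  ultimately show ?thesis by (simp add: algebra_simps)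
qed

lemma primitive_on_continuous:
  assumes "primitive_on T u y"
  shows "continuous_on {0..T} y"
proof -
  have "continuous_on {0..T} (\<lambda>t. y 0 + integral {0..t} u)"
    by (intro continuous_intros indefinite_integral_continuous_1 primitive_on_integrable[OF assms])
  then show ?thesis
    by (rule continuous_on_eq) (metis assms primitive_on_eq)
qed

lemma primitive_on_cong:
  assumes "primitive_on T u y" "0 \<le> T"
    and "\<And>t. t \<in> {0..T} \<Longrightarrow> u t = v t" "\<And>t. t \<in> {0..T} \<Longrightarrow> y t = z t"
  shows "primitive_on T v z"
proof -
  have "v absolutely_integrable_on {0..T}"
    using set_integrable_cong[of lebesgue lebesgue "{0..T}" "{0..T}" u v] assms(3)
      primitive_on_abs[OF assms(1)] by simp
  moreover have "integral {0..t} u = integral {0..t} v" if "t \<in> {0..T}" for t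
    using that assms by (intro Henstock_Kurzweil_Integration.integral_cong) auto
  moreover have "0 \<in> {0..T}" using assms by simp
  ultimately show ?thesis using assms(4) primitive_on_eq[OF assms(1)]
    unfolding primitive_on_def by metis
qed

lemma primitive_on_add:
  assumes "primitive_on T u y" "primitive_on T v z"
  shows "primitive_on T (\<lambda>s. u s + v s) (\<lambda>s. y s + z s)"
  unfolding primitive_on_def
proof (intro conjI ballI)
  show "(\<lambda>s. u s + v s) absolutely_integrable_on {0..T}"
    by (rule set_integral_add(1)[OF assms[THEN primitive_on_abs]])
  fix t assume t: "t \<in> {0..T}"
  then have "u integrable_on {0..t}" "v integrable_on {0..t}"
    using integrable_on_subinterval[OF primitive_on_integrable[OF assms(1)], of 0 t]
      integrable_on_subinterval[OF primitive_on_integrable[OF assms(2)], of 0 t] by auto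
  then show "y t + z t = y 0 + z 0 + integral {0..t} (\<lambda>s. u s + v s)"
    using primitive_on_eq[OF assms(1) t] primitive_on_eq[OF assms(2) t]
    by (simp add: Henstock_Kurzweil_Integration.integral_add)
qed

lemma primitive_on_scaleR:
  assumes "primitive_on T u y"
  shows "primitive_on T (\<lambda>s. c *\<^sub>R u s) (\<lambda>s. c *\<^sub>R y s)"
  unfolding primitive_on_def
proof (intro conjI ballI)
  show "(\<lambda>s. c *\<^sub>R u s) absolutely_integrable_on {0..T}"
    using primitive_on_abs[OF assms] by simp
  fix t assume "t \<in> {0..T}"
  then show "c *\<^sub>R y t = c *\<^sub>R y 0 + integral {0..t} (\<lambda>s. c *\<^sub>R u s)"
    by (simp add: primitive_on_eq[OF assms, of t] scaleR_add_right)
qed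

lemma primitive_on_diff:
  assumes "primitive_on T u y" "primitive_on T v z"
  shows "primitive_on T (\<lambda>s. u s - v s) (\<lambda>s. y s - z s)"
  using primitive_on_add[OF assms(1) primitive_on_scaleR[OF assms(2), of "-1"]] by simp

lemma absolutely_integrable_reverse:
  fixes u :: "real \<Rightarrow> 'a::euclidean_space"
  assumes "u absolutely_integrable_on {0..T}"
  shows "(\<lambda>t. u (T - t)) absolutely_integrable_on {0..T}"
proof -
  have "(\<lambda>x. g (T - x)) integrable_on {0..T}" if "g integrable_on {0..T}"
    for g :: "real \<Rightarrow> 'b::euclidean_space"
    using has_integral_affinity[of g "integral {0..T} g" 0 T "-1" T] integrable_integral[OF that]
    by (auto simp: cbox_interval)
  from this[of u] this[of "\<lambda>x. norm (u x)"] show ?thesis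
    using assms unfolding absolutely_integrable_on_def by simp
qed

text \<open>This turns a terminal value problem into an initial value problem, so each forward
  result below yields its backward counterpart.\<close>

lemma primitive_on_reverse:
  assumes "primitive_on T u y"
  shows "primitive_on T (\<lambda>t. - u (T - t)) (\<lambda>t. y (T - t))"
  unfolding primitive_on_def
proof (intro conjI ballI)
  show "(\<lambda>t. - u (T - t)) absolutely_integrable_on {0..T}"
    using absolutely_integrable_reverse[OF primitive_on_abs[OF assms]]
    by (simp add: absolutely_integrable_on_def integrable_neg_iff)
  fix t assume t: "t \<in> {0..T}"
  have "(u has_integral (y T - y (T - t))) {T-t..T}"
    using primitive_on_diff_eq[OF assms, of "T-t" T] t
      integrable_on_subinterval[OF primitive_on_integrable[OF assms], of "T-t" T]
    by (simp add: has_integral_integral)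
  then have "((\<lambda>x. - u (T - x)) has_integral (- (y T - y (T - t)))) {0..t}"
    using has_integral_affinity[of u "y T - y (T - t)" "T-t" T "-1" T] 
    by (intro has_integral_neg) (simp add: cbox_interval)
  then have "integral {0..t} (\<lambda>x. - u (T - x)) = - (y T - y (T - t))"
    by (rule integral_unique)
  then show "y (T - t) = y (T - 0) + integral {0..t} (\<lambda>x. - u (T - x))"
    by simp
qed

section \<open>Gronwall estimates\<close>

text \<open>The majorant \<open>a + K * integral {0..t} u\<close>, damped by
  \<open>exp (- K * t)\<close>, has derivative K times (u minus the majorant) times a positive
  factor, hence nonpositive. Continuity of \<open>u\<close> makes the integral differentiable at
  every interior time.\<close>

lemma gronwall:
  fixes u :: "real \<Rightarrow> real"
  assumes u: "continuous_on {0..T} u"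
    and le: "\<And>t. t \<in> {0..T} \<Longrightarrow> u t \<le> a + K * integral {0..t} u"
    and t: "t \<in> {0..T}" and "K \<ge> 0"
  shows "u t \<le> a * exp (K * t)"
proof -
  let ?w = "\<lambda>t. (a + K * integral {0..t} u) * exp (- K * t)"
  have int: "u integrable_on {0..T}" using u by (simp add: integrable_continuous_real)
  have "?w t \<le> ?w 0"
  proof (rule DERIV_nonpos_imp_decreasing_open[where f = ?w])
    show "continuous_on {0..t} ?w"
    proof -
      have "continuous_on {0..t} (\<lambda>t. integral {0..t} u)"
        by (rule continuous_on_subset[OF indefinite_integral_continuous_1[OF int]]) (use t in auto)
      then show ?thesis by (intro continuous_intros)
    qed
    fix s assume s: "0 < s" "s < t"
    then have "((\<lambda>t. integral {0..t} u) has_real_derivative u s) (at s within {0..T})"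
      using t by (intro integral_has_real_derivative u) auto
    then have *: "((\<lambda>t. integral {0..t} u) has_real_derivative u s) (at s)"
      using s t by (simp add: at_within_Icc_at)
    have "(?w has_real_derivative K * (u s - (a + K * integral {0..s} u)) * exp (- K * s)) (at s)"
      by (rule derivative_eq_intros * refl | simp)+ (simp add: algebra_simps)
    moreover have "K * (u s - (a + K * integral {0..s} u)) * exp (- K * s) \<le> 0"
      using le[of s] s t \<open>K \<ge> 0\<close> by (simp add: mult_nonneg_nonpos mult_nonpos_nonneg)
    ultimately show "\<exists>y. (?w has_real_derivative y) (at s) \<and> y \<le> 0" by blast
  qed (use t in auto)
  then have "a + K * integral {0..t} u \<le> a * exp (K * t)"
    by (simp add: exp_minus field_simps)
  with le[OF t] show ?thesis by simp
qed

text \<open>The workhorse for every stability estimate: \<open>K\<close> bounds the linear part and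
  \<open>r\<close> collects the error terms. With \<open>r\<close> zero it gives uniqueness and
  Lipschitz dependence on the initial value, with a small \<open>r\<close> the linearisation errors.
  The integral of \<open>r\<close> is enlarged to the whole interval so that Gronwall sees a
  constant.\<close>

lemma primitive_on_norm_bound:
  fixes y :: "real \<Rightarrow> 'a::euclidean_space"
  assumes y: "primitive_on T u y"
    and bound: "\<And>s. s \<in> {0..T} \<Longrightarrow> norm (u s) \<le> K * norm (y s) + r s"
    and r: "r integrable_on {0..T}" "\<And>s. s \<in> {0..T} \<Longrightarrow> r s \<ge> 0"
    and K: "K \<ge> 0" and t: "t \<in> {0..T}"
  shows "norm (y t) \<le> (norm (y 0) + integral {0..T} r) * exp (K * T)"
proof -
  let ?a = "norm (y 0) + integral {0..T} r"
  have cont: "continuous_on {0..T} (\<lambda>s. norm (y s))"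
    by (intro continuous_intros primitive_on_continuous[OF y])
  have "norm (y t) \<le> ?a * exp (K * t)"
  proof (rule gronwall[OF cont _ t K])
    fix t assume t: "t \<in> {0..T}"
    have u: "u integrable_on {0..t}" and r': "r integrable_on {0..t}"
      using integrable_on_subinterval[OF primitive_on_integrable[OF y], of 0 t]
        integrable_on_subinterval[OF r(1), of 0 t] t by auto
    have i: "(\<lambda>s. norm (y s)) integrable_on {0..t}"
      using cont t by (intro integrable_continuous_real) (auto intro: continuous_on_subset)
    have "norm (integral {0..t} u) \<le> integral {0..t} (\<lambda>s. K * norm (y s) + r s)"
      using t bound by (intro Henstock_Kurzweil_Integration.integral_norm_bound_integral u integrable_add r' integrable_on_mult_right i) auto
    also have "\<dots> = K * integral {0..t} (\<lambda>s. norm (y s)) + integral {0..t} r"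
      using i r' by (simp add: Henstock_Kurzweil_Integration.integral_add integrable_on_mult_right)
    also have "integral {0..t} r \<le> integral {0..T} r"
      using t r r' by (intro integral_subset_le) auto
    finally have "norm (integral {0..t} u) \<le> K * integral {0..t} (\<lambda>s. norm (y s)) + integral {0..T} r"
      by simp
    moreover have "y t = y 0 + integral {0..t} u" using y t by (rule primitive_on_eq)
    ultimately show "norm (y t) \<le> ?a + K * integral {0..t} (\<lambda>s. norm (y s))"
      using norm_triangle_ineq[of "y 0" "integral {0..t} u"] by simp
  qed
  also have "\<dots> \<le> ?a * exp (K * T)"
  proof (rule mult_left_mono)
    show "exp (K * t) \<le> exp (K * T)" using t K by (simp add: mult_left_mono)
    show "0 \<le> ?a" by (intro add_nonneg_nonneg integral_nonneg r norm_ge_zero)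
  qed
  finally show ?thesis .
qed

text \<open>The version for the costate and \<alpha>, whose data are given at time T; reversal
  leaves the total integral of \<open>r\<close> unchanged.\<close>

lemma primitive_on_norm_bound_backward:
  fixes y :: "real \<Rightarrow> 'a::euclidean_space"
  assumes y: "primitive_on T u y"
    and bound: "\<And>s. s \<in> {0..T} \<Longrightarrow> norm (u s) \<le> K * norm (y s) + r s"
    and r: "r absolutely_integrable_on {0..T}" "\<And>s. s \<in> {0..T} \<Longrightarrow> r s \<ge> 0"
    and K: "K \<ge> 0" and t: "t \<in> {0..T}"
  shows "norm (y t) \<le> (norm (y T) + integral {0..T} r) * exp (K * T)"
proof -
  have "((\<lambda>x. r (T - x)) has_integral integral {0..T} r) {0..T}"
    using has_integral_affinity[of r "integral {0..T} r" 0 T "-1" T] r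
    by (simp add: cbox_interval has_integral_integral absolutely_integrable_on_def)
  then have "integral {0..T} (\<lambda>x. r (T - x)) = integral {0..T} r"
    by (rule integral_unique)
  moreover have "norm (y (T - (T - t))) \<le> (norm (y (T - 0)) + integral {0..T} (\<lambda>x. r (T - x))) * exp (K * T)"
    by (rule primitive_on_norm_bound[OF primitive_on_reverse[OF y]])
      (use bound r K t absolutely_integrable_reverse[OF r(1)] in \<open>auto simp: absolutely_integrable_on_def\<close>)
  ultimately show ?thesis by simp
qed

text \<open>Absolutely continuous functions need not be differentiable everywhere, so the product rule is
  proved by comparing increments: on a short interval the increment of the difference of both sides
  is at most the oscillation of \<open>y\<close> and \<open>z\<close> times the integral of \<open>norm u + norm v\<close>.\<close>

lemma primitive_on_inner:
  fixes y z :: "real \<Rightarrow> 'a::euclidean_space"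
  assumes y: "primitive_on T u y" and z: "primitive_on T v z" and T: "0 \<le> T"
  shows "y T \<bullet> z T - y 0 \<bullet> z 0 = integral {0..T} (\<lambda>s. u s \<bullet> z s + y s \<bullet> v s)"
proof -
  let ?h = "\<lambda>s. u s \<bullet> z s + y s \<bullet> v s" and ?m = "\<lambda>s. norm (u s) + norm (v s)"
  have cont: "continuous_on {0..T} y" "continuous_on {0..T} z"
    using y z primitive_on_continuous by auto
  have prod: "(\<lambda>s. w s \<bullet> x s) absolutely_integrable_on {0..T}"
    if "w absolutely_integrable_on {0..T}" "continuous_on {0..T} x" for w x :: "real \<Rightarrow> 'a"
  proof -
    show ?thesis
    proof (rule absolutely_integrable_bounded_measurable_product[where h = "\<lambda>a b. b \<bullet> a"])
      show "bilinear (\<lambda>a b::'a. b \<bullet> a)"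
        by (auto simp: bilinear_def linear_iff inner_simps)
      show "x \<in> borel_measurable (lebesgue_on {0..T})"
        using that by (intro continuous_imp_measurable_on_sets_lebesgue) auto
      show "bounded (x ` {0..T})"
        using that by (intro compact_imp_bounded compact_continuous_image) auto
    qed (use that in auto)
  qed
  have "?h absolutely_integrable_on {0..T}"
    using set_integral_add(1)[OF prod[OF primitive_on_abs[OF y] cont(2)] prod[OF primitive_on_abs[OF z] cont(1)]]
    by (simp add: inner_commute)
  then have h: "?h integrable_on {0..T}"
    by (simp add: absolutely_integrable_on_def)
  have m: "?m integrable_on {0..T}"
    using primitive_on_abs[OF y] primitive_on_abs[OF z]
    by (intro integrable_add) (auto simp: absolutely_integrable_on_def)
  have local: "norm (y b \<bullet> z b - y a \<bullet> z a - integral {a..b} ?h) \<le> e * integral {a..b} ?m"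
    if ab: "0 \<le> a" "a \<le> b" "b \<le> T"
      and osc: "\<And>s. s \<in> {a..b} \<Longrightarrow> norm (z b - z s) \<le> e \<and> norm (y a - y s) \<le> e" for a b e
  proof -
    have sub: "w integrable_on {a..b}" if "w integrable_on {0..T}" for w :: "real \<Rightarrow> 'x::euclidean_space"
      using that ab by (meson atLeastatMost_subset_iff integrable_on_subinterval)
    note [intro] = sub[OF h] sub[OF m] sub[OF primitive_on_integrable[OF y]] sub[OF primitive_on_integrable[OF z]]
    have dy: "y b - y a = integral {a..b} u" and dz: "z b - z a = integral {a..b} v"
      using primitive_on_diff_eq[OF y ab] primitive_on_diff_eq[OF z ab] by auto
    \<comment> \<open>Freezing z at the right end and y at the left end makes the approximating
      integrand exact: its two parts add up to the increment of the inner product with no mixed term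
      left over.\<close>
    have iu: "((\<lambda>s. u s \<bullet> z b) has_integral (y b - y a) \<bullet> z b) {a..b}"
      using has_integral_linear[OF _ bounded_linear_inner_left[of "z b"], of u "y b - y a" "{a..b}"]
        integrable_integral[OF sub[OF primitive_on_integrable[OF y]]] by (simp add: o_def dy)
    have iv: "((\<lambda>s. y a \<bullet> v s) has_integral y a \<bullet> (z b - z a)) {a..b}"
      using has_integral_linear[OF _ bounded_linear_inner_right[of "y a"], of v "z b - z a" "{a..b}"]
        integrable_integral[OF sub[OF primitive_on_integrable[OF z]]] by (simp add: o_def dz)
    have "((\<lambda>s. u s \<bullet> z b + y a \<bullet> v s - ?h s) has_integral
        ((y b - y a) \<bullet> z b + y a \<bullet> (z b - z a) - integral {a..b} ?h)) {a..b}"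
      by (intro has_integral_diff has_integral_add iu iv integrable_integral) auto
    moreover have "(y b - y a) \<bullet> z b + y a \<bullet> (z b - z a) = y b \<bullet> z b - y a \<bullet> z a"
      by (simp add: inner_simps)
    moreover have "u s \<bullet> z b + y a \<bullet> v s - ?h s = u s \<bullet> (z b - z s) + (y a - y s) \<bullet> v s" for s
      by (simp add: inner_simps)
    ultimately have I: "((\<lambda>s. u s \<bullet> (z b - z s) + (y a - y s) \<bullet> v s) has_integral
        (y b \<bullet> z b - y a \<bullet> z a - integral {a..b} ?h)) {a..b}"
      by (simp only:)
    have "norm (integral {a..b} (\<lambda>s. u s \<bullet> (z b - z s) + (y a - y s) \<bullet> v s)) \<le> integral {a..b} (\<lambda>s. e * ?m s)"
    proof (rule Henstock_Kurzweil_Integration.integral_norm_bound_integral)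
      fix s assume s: "s \<in> {a..b}"
      have "\<bar>u s \<bullet> (z b - z s)\<bar> \<le> norm (u s) * e"
        using Cauchy_Schwarz_ineq2 osc[OF s] by (meson mult_left_mono norm_ge_zero order_trans)
      moreover have "\<bar>(y a - y s) \<bullet> v s\<bar> \<le> e * norm (v s)"
        using Cauchy_Schwarz_ineq2 osc[OF s] by (meson mult_right_mono norm_ge_zero order_trans)
      ultimately show "norm (u s \<bullet> (z b - z s) + (y a - y s) \<bullet> v s) \<le> e * ?m s"
        by (simp add: algebra_simps abs_le_iff)
    qed (use I in \<open>auto intro!: integrable_on_mult_right\<close>)
    then show ?thesis using I by (simp add: integral_unique)
  qed
  define G where "G = y T \<bullet> z T - y 0 \<bullet> z 0 - integral {0..T} ?h"
  have bound: "norm G \<le> e * integral {0..T} ?m" if "e > 0" for e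
  proof -
    have "uniformly_continuous_on {0..T} y" "uniformly_continuous_on {0..T} z"
      using cont by (auto intro: compact_uniformly_continuous)
    then obtain d1 d2 where d: "d1 > 0" "d2 > 0"
      "\<And>s t. s \<in> {0..T} \<Longrightarrow> t \<in> {0..T} \<Longrightarrow> dist s t < d1 \<Longrightarrow> dist (y s) (y t) < e"
      "\<And>s t. s \<in> {0..T} \<Longrightarrow> t \<in> {0..T} \<Longrightarrow> dist s t < d2 \<Longrightarrow> dist (z s) (z t) < e"
      unfolding uniformly_continuous_on_def using \<open>e > 0\<close> by metis
    \<comment> \<open>The mesh T / n lies below both moduli of continuity; the strict inequality
      excludes n = 0 even when T = 0.\<close>
    obtain n :: nat where n: "T < real n * min d1 d2"
      using reals_Archimedean3[of "min d1 d2"] d(1,2) by (metis min_less_iff_conj)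
    then have n0: "n > 0" using T by (cases n) auto
    define \<tau> where "\<tau> i = T * real i / real n" for i :: nat
    have step: "\<tau> (Suc i) - \<tau> i = T / n" for i by (simp add: \<tau>_def distrib_left add_divide_distrib)
    have small: "T / n < min d1 d2"
      unfolding pos_divide_less_eq[OF of_nat_0_less_iff[THEN iffD2, OF n0]] using n by (simp only: mult.commute)
    have \<tau>mono: "\<tau> i \<le> \<tau> j" if "i \<le> j" for i j
      using that T by (simp add: \<tau>_def divide_right_mono mult_left_mono)
    have \<tau>n: "\<tau> n = T" "\<tau> 0 = 0" using n0 by (auto simp: \<tau>_def)
    have "norm (y (\<tau> k) \<bullet> z (\<tau> k) - y 0 \<bullet> z 0 - integral {0..\<tau> k} ?h) \<le> e * integral {0..\<tau> k} ?m"
      if "k \<le> n" for k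
      using that
    proof (induction k)
      case 0
      then show ?case by (simp add: \<tau>n)
    next
      case (Suc k)
      have k: "0 \<le> \<tau> k" "\<tau> k \<le> \<tau> (Suc k)" "\<tau> (Suc k) \<le> T"
        using \<tau>mono[of 0 k] \<tau>mono[of k "Suc k"] \<tau>mono[of "Suc k" n] Suc.prems \<tau>n by auto
      have comb: "integral {0..\<tau> k} w + integral {\<tau> k..\<tau> (Suc k)} w = integral {0..\<tau> (Suc k)} w"
        if "w integrable_on {0..T}" for w :: "real \<Rightarrow> real"
        using k by (intro Henstock_Kurzweil_Integration.integral_combine integrable_on_subinterval[OF that]) auto
      have "norm (y (\<tau> (Suc k)) \<bullet> z (\<tau> (Suc k)) - y (\<tau> k) \<bullet> z (\<tau> k) - integral {\<tau> k..\<tau> (Suc k)} ?h)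
          \<le> e * integral {\<tau> k..\<tau> (Suc k)} ?m"
      proof (rule local[OF k])
        fix s assume s: "s \<in> {\<tau> k..\<tau> (Suc k)}"
        have "dist (\<tau> (Suc k)) s < d2" "dist (\<tau> k) s < d1"
          using s step[of k] small by (auto simp: dist_real_def)
        then show "norm (z (\<tau> (Suc k)) - z s) \<le> e \<and> norm (y (\<tau> k) - y s) \<le> e"
          using d(3)[of "\<tau> k" s] d(4)[of "\<tau> (Suc k)" s] s k by (auto simp: dist_norm less_imp_le)
      qed
      then have "norm (y (\<tau> (Suc k)) \<bullet> z (\<tau> (Suc k)) - y 0 \<bullet> z 0 - integral {0..\<tau> (Suc k)} ?h)
          \<le> e * (integral {0..\<tau> k} ?m + integral {\<tau> k..\<tau> (Suc k)} ?m)"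
        using Suc comb[OF h] unfolding distrib_left by (simp add: abs_le_iff)
      then show ?case using comb[OF m] by simp
    qed
    from this[of n] show ?thesis by (simp add: G_def \<tau>n)
  qed
  have *: "norm G \<le> e" if "e > 0" for e
  proof -
    have m0: "integral {0..T} ?m \<ge> 0" by (rule integral_nonneg) (use m in auto)
    \<comment> \<open>Adding 1 to the denominator covers a vanishing integral.\<close>
    have "e / (integral {0..T} ?m + 1) > 0" using that m0 by simp
    then have "norm G \<le> e / (integral {0..T} ?m + 1) * integral {0..T} ?m"
      by (rule bound)
    also have "\<dots> \<le> e" using that m0 by (simp add: field_simps)
    finally show ?thesis .
  qed
  have "G = 0" using field_le_epsilon[of "norm G" 0] * by auto
  then show ?thesis by (simp add: G_def)
qed

section \<open>Caratheodory equations\<close>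

text \<open>For a simple function in place of \<open>Y\<close> the composite is glued from finitely
  many measurable pieces; continuity of \<open>H t\<close> carries measurability to the pointwise
  limit.\<close>

lemma borel_measurable_caratheodory:
  fixes H :: "'t \<Rightarrow> 'a::euclidean_space \<Rightarrow> 'b::euclidean_space"
  assumes H: "\<And>\<xi>. (\<lambda>t. H t \<xi>) \<in> borel_measurable M"
    and cont: "\<And>t. t \<in> space M \<Longrightarrow> continuous_on UNIV (H t)"
    and Y: "Y \<in> borel_measurable M"
  shows "(\<lambda>t. H t (Y t)) \<in> borel_measurable M"
proof -
  obtain s where s: "\<And>i. simple_function M (s i)"
    and lim: "\<And>t. t \<in> space M \<Longrightarrow> (\<lambda>i. s i t) \<longlonglongrightarrow> Y t"
    using borel_measurable_implies_sequence_metric[OF Y] by metis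
  show ?thesis
  proof (rule borel_measurable_LIMSEQ_metric)
    fix i :: nat
    have fin: "finite (s i ` space M)" using s[of i] by (simp add: simple_function_def)
    have "s i \<in> M \<rightarrow>\<^sub>M count_space (s i ` space M)"
      using s[of i] by (auto simp: measurable_count_space_eq2[OF fin] simple_function_def)
    then show "(\<lambda>t. H t (s i t)) \<in> borel_measurable M"
      by (rule measurable_compose_countable'[where f = "\<lambda>\<xi> t. H t \<xi>", OF H])
        (simp add: fin countable_finite)
  next
    fix t assume t: "t \<in> space M"
    then have "isCont (H t) (Y t)"
      using cont by (simp add: continuous_on_eq_continuous_at)
    then show "(\<lambda>i. H t (s i t)) \<longlonglongrightarrow> H t (Y t)"
      using lim[OF t] by (rule isCont_tendsto_compose)
  qed
qed

lemma borel_measurable_caratheodory_interval: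
  fixes H :: "real \<Rightarrow> 'a::euclidean_space \<Rightarrow> 'b::euclidean_space"
  assumes "\<And>\<xi>. (\<lambda>t. H t \<xi>) \<in> borel_measurable (lebesgue_on {0..T})"
    and "\<And>t. t \<in> {0..T} \<Longrightarrow> continuous_on UNIV (H t)"
    and "continuous_on {0..T} Y"
  shows "(\<lambda>t. H t (Y t)) \<in> borel_measurable (lebesgue_on {0..T})"
proof (rule borel_measurable_caratheodory[OF assms(1)])
  show "Y \<in> borel_measurable (lebesgue_on {0..T})"
    using assms(3) by (rule continuous_imp_measurable_on_sets_lebesgue) simp
qed (use assms(2) in simp)

text \<open>Integrability is demanded along every continuous curve, which is what the Picard
  operator needs to be defined. The Lipschitz constant does not depend on time.\<close>

definition integrable_lipschitz_field ::
  "real \<Rightarrow> real \<Rightarrow> (real \<Rightarrow> 'a::euclidean_space \<Rightarrow> 'a) \<Rightarrow> bool" where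
  "integrable_lipschitz_field T K F \<longleftrightarrow> 0 \<le> K \<and>
     (\<forall>y. continuous_on {0..T} y \<longrightarrow> (\<lambda>s. F s (y s)) absolutely_integrable_on {0..T}) \<and>
     (\<forall>s\<in>{0..T}. \<forall>y z. norm (F s y - F s z) \<le> K * norm (y - z))"

text \<open>Bounded continuous functions on the whole line form a complete metric space as a type;
  freezing a curve outside \<open>{0..T}\<close> embeds it there, so Banach's theorem applies
  directly.\<close>

lemma clamped_bcontfun:
  fixes g :: "real \<Rightarrow> 'a::real_normed_vector"
  assumes "continuous_on {0..T} g" "0 \<le> T"
  shows "(\<lambda>t. g (max 0 (min T t))) \<in> bcontfun"
  unfolding bcontfun_def
proof (intro CollectI conjI)
  show "continuous_on UNIV (\<lambda>t. g (max 0 (min T t)))"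
    by (rule continuous_on_compose2[OF assms(1)]) (use assms in \<open>auto intro!: continuous_intros\<close>)
  have "bounded (g ` {0..T})"
    using assms by (intro compact_imp_bounded compact_continuous_image) auto
  then show "bounded (range (\<lambda>t. g (max 0 (min T t))))"
    by (rule bounded_subset) (use assms in auto)
qed

text \<open>In the exponentially weighted supremum norm the integral operator is a contraction on the
  whole interval, so that no gluing of local solutions is needed.\<close>

lemma caratheodory_solution_exists:
  fixes F :: "real \<Rightarrow> 'a::euclidean_space \<Rightarrow> 'a"
  assumes F: "integrable_lipschitz_field T K F" and T: "0 \<le> T"
  shows "\<exists>y. primitive_on T (\<lambda>s. F s (y s)) y \<and> y 0 = x"
proof -
  \<comment> \<open>The contraction factor will be \<open>K / w\<close>; this rate makes it at most
    1/2 and stays positive when K = 0.\<close>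
  define w where "w = 2 * K + 1"
  have K: "0 \<le> K" and w: "w > 0" using F by (auto simp: integrable_lipschitz_field_def w_def)
  have lip: "norm (F s y - F s z) \<le> K * norm (y - z)" if "s \<in> {0..T}" for s y z
    using F that unfolding integrable_lipschitz_field_def by blast
  let ?u = "\<lambda>z s. F s (exp (w * s) *\<^sub>R apply_bcontfun z s)"
  have abs: "?u z absolutely_integrable_on {0..T}" for z
  proof -
    have "continuous_on {0..T} (\<lambda>s. exp (w * s) *\<^sub>R apply_bcontfun z s)"
      by (intro continuous_intros continuous_on_apply_bcontfun)
    then show ?thesis using F unfolding integrable_lipschitz_field_def by blast
  qed
  then have int: "?u z integrable_on {0..T}" for z
    by (simp add: absolutely_integrable_on_def)
  \<comment> \<open>The Picard operator in the rescaled unknown z(t) = exp (- w t) y(t): the plain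
    supremum norm of z is the weighted norm of y.\<close>
  define G where "G z t = exp (- w * t) *\<^sub>R (x + integral {0..t} (?u z))" for z t
  define op where "op z = Bcontfun (\<lambda>t. G z (max 0 (min T t)))" for z
  have "continuous_on {0..T} (G z)" for z
    unfolding G_def by (intro continuous_intros indefinite_integral_continuous_1 int)
  then have op: "apply_bcontfun (op z) t = G z (max 0 (min T t))" for z t
    unfolding op_def using T by (simp add: Bcontfun_inverse clamped_bcontfun)
  have G_contr: "dist (G z1 t) (G z2 t) \<le> 1/2 * dist z1 z2" if t: "t \<in> {0..T}" for z1 z2 t
  proof -
    have sub: "?u z integrable_on {0..t}" for z
      by (rule integrable_on_subinterval[OF int]) (use t in auto)
    have expint: "((\<lambda>s. exp (w * s)) has_integral (exp (w * t) / w - exp (w * 0) / w)) {0..t}"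
      using t w
      by (intro fundamental_theorem_of_calculus)
        (auto intro!: derivative_eq_intros simp flip: has_real_derivative_iff_has_vector_derivative)
    have "norm (integral {0..t} (?u z1) - integral {0..t} (?u z2))
        = norm (integral {0..t} (\<lambda>s. ?u z1 s - ?u z2 s))"
      by (simp add: Henstock_Kurzweil_Integration.integral_diff sub)
    also have "\<dots> \<le> integral {0..t} (\<lambda>s. K * dist z1 z2 * exp (w * s))"
    proof (rule Henstock_Kurzweil_Integration.integral_norm_bound_integral)
      fix s assume s: "s \<in> {0..t}"
      have "norm (?u z1 s - ?u z2 s) \<le> K * norm (exp (w * s) *\<^sub>R (apply_bcontfun z1 s - apply_bcontfun z2 s))"
        using lip[of s "exp (w * s) *\<^sub>R apply_bcontfun z1 s" "exp (w * s) *\<^sub>R apply_bcontfun z2 s"] s t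
        by (simp add: scaleR_diff_right)
      also have "\<dots> = K * exp (w * s) * dist (apply_bcontfun z1 s) (apply_bcontfun z2 s)"
        by (simp add: dist_norm)
      also have "\<dots> \<le> K * exp (w * s) * dist z1 z2"
        using K by (intro mult_left_mono dist_bounded) auto
      finally show "norm (?u z1 s - ?u z2 s) \<le> K * dist z1 z2 * exp (w * s)" by (simp add: mult_ac)
    qed (use sub expint in \<open>auto intro!: integrable_diff integrable_on_mult_right\<close>)
    also have "\<dots> = K * dist z1 z2 * (exp (w * t) / w - 1 / w)"
      using expint by (simp add: integral_unique)
    also have "\<dots> \<le> K * dist z1 z2 * (exp (w * t) / w)"
      using K w by (intro mult_left_mono) auto
    finally have *: "norm (integral {0..t} (?u z1) - integral {0..t} (?u z2)) \<le> K * dist z1 z2 * (exp (w * t) / w)" .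
    have "dist (G z1 t) (G z2 t) = exp (- w * t) * norm (integral {0..t} (?u z1) - integral {0..t} (?u z2))"
      by (simp add: G_def dist_norm flip: scaleR_diff_right)
    also have "\<dots> \<le> exp (- w * t) * (K * dist z1 z2 * (exp (w * t) / w))"
      using * by (intro mult_left_mono) auto
    also have "\<dots> = K / w * dist z1 z2"
      by (simp add: exp_minus field_simps)
    also have "\<dots> \<le> 1/2 * dist z1 z2"
      using K w by (intro mult_right_mono) (auto simp: w_def field_simps)
    finally show ?thesis .
  qed
  have "dist (op z1) (op z2) \<le> 1/2 * dist z1 z2" for z1 z2
    by (rule dist_bound) (unfold op, rule G_contr, use T in auto)
  then obtain z where z: "op z = z"
    using banach_fix_type[of "1/2" op] by auto
  have zt: "apply_bcontfun z t = G z t" if "t \<in> {0..T}" for t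
    using op[of z t] that z by simp
  define y where "y s = exp (w * s) *\<^sub>R apply_bcontfun z s" for s
  have yt: "y t = x + integral {0..t} (?u z)" if "t \<in> {0..T}" for t
    using that by (simp add: y_def zt G_def flip: exp_add)
  have y0: "y 0 = x" using yt[of 0] T by simp
  moreover have "primitive_on T (?u z) y"
    unfolding primitive_on_def using abs[of z] yt y0 by simp
  then have "primitive_on T (\<lambda>s. F s (y s)) y" by (simp add: y_def[symmetric])
  ultimately show ?thesis by blast
qed

lemma integrable_lipschitz_field_reverse:
  assumes "integrable_lipschitz_field T K F"
  shows "integrable_lipschitz_field T K (\<lambda>t y. - F (T - t) y)"
  unfolding integrable_lipschitz_field_def
proof (intro conjI allI impI ballI)
  fix y :: "real \<Rightarrow> 'a" assume "continuous_on {0..T} y"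
  then have "continuous_on {0..T} (\<lambda>s. y (T - s))"
    by (rule continuous_on_compose2) (auto intro!: continuous_intros)
  then have "(\<lambda>s. F s (y (T - s))) absolutely_integrable_on {0..T}"
    using assms unfolding integrable_lipschitz_field_def by blast
  from absolutely_integrable_reverse[OF this]
  show "(\<lambda>s. - F (T - s) (y s)) absolutely_integrable_on {0..T}"
    by (simp add: absolutely_integrable_on_def integrable_neg_iff)
next
  fix s y z assume "s \<in> {0..T}"
  then have "norm (F (T - s) z - F (T - s) y) \<le> K * norm (z - y)"
    using assms unfolding integrable_lipschitz_field_def by simp
  then show "norm (- F (T - s) y - - F (T - s) z) \<le> K * norm (y - z)"
    by (simp add: norm_minus_commute)
qed (use assms in \<open>simp add: integrable_lipschitz_field_def\<close>)

lemma caratheodory_solution_exists_backward: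
  fixes F :: "real \<Rightarrow> 'a::euclidean_space \<Rightarrow> 'a"
  assumes F: "integrable_lipschitz_field T K F" and T: "0 \<le> T"
  shows "\<exists>y. primitive_on T (\<lambda>s. F s (y s)) y \<and> y T = x"
proof -
  obtain y where y: "primitive_on T (\<lambda>s. - F (T - s) (y s)) y" "y 0 = x"
    using caratheodory_solution_exists[OF integrable_lipschitz_field_reverse[OF F] T] by blast
  from primitive_on_reverse[OF y(1)] show ?thesis
    using y(2) by (intro exI[of _ "\<lambda>t. y (T - t)"]) simp
qed

text \<open>The difference of two solutions satisfies the norm bound with zero forcing, so vanishing
  at one end spreads to the whole interval. The disjunction serves initial and terminal value
  problems alike.\<close>

lemma primitive_on_unique:
  assumes y: "primitive_on T (\<lambda>s. F s (y s)) y" and z: "primitive_on T (\<lambda>s. F s (z s)) z"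
    and lip: "\<And>s y z. s \<in> {0..T} \<Longrightarrow> norm (F s y - F s z) \<le> K * norm (y - z)"
    and K: "0 \<le> K" and eq: "y 0 = z 0 \<or> y T = z T" and t: "t \<in> {0..T}"
  shows "y t = z t"
proof -
  note d = primitive_on_diff[OF y z]
  have "norm (y t - z t) \<le> 0"
    using eq
  proof
    assume "y 0 = z 0"
    then show ?thesis
      using primitive_on_norm_bound[OF d, of K "\<lambda>_. 0" t] lip K t by (simp add: integrable_0)
  next
    assume "y T = z T"
    then show ?thesis
      using primitive_on_norm_bound_backward[OF d, of K "\<lambda>_. 0" t] lip K t by (simp add: integrable_0)
  qed
  then show ?thesis by simp
qed

section \<open>Gradients, Jacobians and Hessians\<close>

lemma LIMSEQ_one_over_Suc: "(\<lambda>n. 1 / real (Suc n)) \<longlonglongrightarrow> 0"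
  using LIMSEQ_inverse_real_of_nat by (simp add: inverse_eq_divide)

text \<open>The norm on the matrix type is the Frobenius norm, so Cauchy-Schwarz is applied row by
  row.\<close>

lemma norm_matrix_vector_mult_le:
  fixes A :: "real^'n^'m"
  shows "norm (A *v x) \<le> norm A * norm x"
proof -
  have "norm (A *v x) \<le> L2_set (\<lambda>i. norm (A $ i) * norm x) UNIV"
    unfolding norm_vec_def[of "A *v x"]
    by (rule L2_set_mono) (auto simp: matrix_mult_dot Cauchy_Schwarz_ineq2)
  also have "\<dots> = norm A * norm x"
    by (simp add: norm_vec_def[of A] L2_set_left_distrib)
  finally show ?thesis .
qed

lemma norm_transpose:
  fixes A :: "real^'n^'m"
  shows "norm (transpose A) = norm A"
proof -
  have "(norm (transpose A))\<^sup>2 = (\<Sum>i\<in>UNIV. \<Sum>j\<in>UNIV. (A $ j $ i)\<^sup>2)"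
    by (simp add: power2_norm_eq_inner inner_vec_def transpose_def power2_eq_square[of "A $ _ $ _"])
  also have "\<dots> = (norm A)\<^sup>2"
    by (subst sum.swap) (simp add: power2_norm_eq_inner inner_vec_def power2_eq_square[of "A $ _ $ _"])
  finally show ?thesis by (simp add: power2_eq_iff_nonneg)
qed

text \<open>An operator norm bound controls each entry, and the Frobenius norm is at most the sum of
  the absolute entries; this is the origin of the dimension factors. Only a finite constant is
  wanted, not a sharp one.\<close>

lemma norm_matrix_le_of_columns:
  fixes A :: "real^'n^'m"
  assumes "\<And>h. norm (A *v h) \<le> c * norm h"
  shows "norm A \<le> real CARD('m) * real CARD('n) * c"
proof -
  have entry: "\<bar>A $ i $ j\<bar> \<le> c" for i j
    using matrix_component_le_onorm[of A i j] onorm_le[of "\<lambda>h. A *v h" c] assms by force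
  have "norm A \<le> (\<Sum>i\<in>UNIV. norm (A $ i))"
    unfolding norm_vec_def[of A] by (rule L2_set_le_sum) auto
  also have "\<dots> \<le> (\<Sum>i\<in>(UNIV::'m set). \<Sum>j\<in>(UNIV::'n set). c)"
    by (intro sum_mono order_trans[OF norm_le_l1_cart] entry)
  finally show ?thesis by simp
qed

lemma linear_eq_sum_axis:
  fixes f :: "real^'n \<Rightarrow> 'a::real_vector"
  assumes "linear f"
  shows "f h = (\<Sum>i\<in>UNIV. h $ i *\<^sub>R f (axis i 1))"
proof -
  have "f h = f (\<Sum>i\<in>UNIV. h $ i *\<^sub>R axis i 1)"
    using basis_expansion[of h] by (simp add: scalar_mult_eq_scaleR)
  also have "\<dots> = (\<Sum>i\<in>UNIV. h $ i *\<^sub>R f (axis i 1))"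
    using assms by (simp add: linear_sum linear_scale)
  finally show ?thesis .
qed

lemma has_derivative_grad:
  assumes "g differentiable (at x)"
  shows "(g has_derivative (\<lambda>h. grad g x \<bullet> h)) (at x)"
proof -
  have d: "(g has_derivative frechet_derivative g (at x)) (at x)"
    using assms by (simp add: frechet_derivative_works)
  have "frechet_derivative g (at x) h = grad g x \<bullet> h" for h
    using linear_eq_sum_axis[OF has_derivative_linear[OF d], of h]
    by (simp add: grad_def inner_vec_def mult.commute)
  then have "frechet_derivative g (at x) = (\<lambda>h. grad g x \<bullet> h)" by blast
  with d show ?thesis by simp
qed

lemma grad_eqI:
  assumes "(g has_derivative (\<lambda>h. v \<bullet> h)) (at x)"
  shows "grad g x = v"
proof -
  have "frechet_derivative g (at x) = (\<lambda>h. v \<bullet> h)"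
    using frechet_derivative_at[OF assms] by simp
  then show ?thesis by (simp add: grad_def vec_eq_iff inner_axis)
qed

lemma has_derivative_hess:
  "grad g differentiable (at x) \<Longrightarrow> (grad g has_derivative (\<lambda>h. hess g x *v h)) (at x)"
  unfolding hess_def by (simp add: jacobian_works)

lemma differentiable_vec_componentwise:
  fixes F :: "'a::real_normed_vector \<Rightarrow> real^'n"
  assumes "\<And>k. (\<lambda>\<xi>. F \<xi> $ k) differentiable (at x)"
  shows "F differentiable (at x)"
proof -
  obtain D where D: "\<And>k. ((\<lambda>\<xi>. F \<xi> $ k) has_derivative D k) (at x)"
    using assms unfolding differentiable_def by metis
  have "(F has_derivative (\<lambda>h. \<chi> k. D k h)) (at x)"
    by (subst has_derivative_componentwise_within)
      (use D in \<open>auto simp: Basis_vec_def inner_axis\<close>)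
  then show ?thesis by (auto simp: differentiable_def)
qed

lemma jacobian_row:
  assumes "F differentiable (at x)"
  shows "jacobian F (at x) $ k = grad (\<lambda>\<xi>. F \<xi> $ k) x"
proof -
  have "(F has_derivative (\<lambda>h. jacobian F (at x) *v h)) (at x)"
    using assms by (simp add: jacobian_works)
  then have "((\<lambda>\<xi>. F \<xi> $ k) has_derivative (\<lambda>h. (jacobian F (at x) *v h) $ k)) (at x)"
    by (rule bounded_linear.has_derivative[OF bounded_linear_vec_nth])
  then show ?thesis
    by (intro grad_eqI[symmetric]) (simp add: matrix_mult_dot)
qed

lemma jacobian_transpose_mult:
  assumes "F differentiable (at x)"
  shows "transpose (jacobian F (at x)) *v P = (\<Sum>k\<in>UNIV. P $ k *\<^sub>R grad (\<lambda>\<xi>. F \<xi> $ k) x)"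
  by (simp add: vec_eq_iff matrix_vector_mult_def transpose_def jacobian_row[OF assms] sum_component
      mult.commute)

lemma D2_transpose_mult:
  "D2_transpose F x P *v h = (\<Sum>k\<in>UNIV. P $ k *\<^sub>R (hess (\<lambda>\<xi>. F \<xi> $ k) x *v h))"
  by (simp add: vec_eq_iff D2_transpose_def matrix_vector_mult_def sum_component sum_distrib_left
      sum_distrib_right mult.assoc) (subst sum.swap, simp)

text \<open>For fixed \<open>P\<close> the transposed Jacobian applied to \<open>P\<close> is a
  fixed linear combination of the gradients of the components of \<open>F\<close>, so its derivative
  is the same combination of their Hessians.\<close>

lemma has_derivative_jacobian_transpose:
  assumes "\<And>k. twice_differentiable (\<lambda>\<xi>. F \<xi> $ k)"
  shows "((\<lambda>\<xi>. transpose (jacobian F (at \<xi>)) *v P) has_derivative (\<lambda>h. D2_transpose F x P *v h)) (at x)"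
proof -
  have F: "F differentiable (at \<xi>)" for \<xi>
    using assms by (intro differentiable_vec_componentwise) (auto simp: twice_differentiable_def)
  show ?thesis
    unfolding jacobian_transpose_mult[OF F] D2_transpose_mult
    using assms by (auto intro!: derivative_intros has_derivative_hess simp: twice_differentiable_def)
qed

text \<open>Mean value theorem first along \<open>u\<close>, then along \<open>v\<close>. Symmetry of the Hessian follows because the
  left-hand side is symmetric in \<open>u\<close> and \<open>v\<close>.\<close>

lemma second_difference_mvt:
  fixes g :: "real^'d \<Rightarrow> real"
  assumes g: "twice_differentiable g"
  shows "\<exists>a\<in>{0..1}. \<exists>b\<in>{0..1}. g (x + u + v) - g (x + u) - g (x + v) + g x
    = u \<bullet> (hess g (x + a *\<^sub>R u + b *\<^sub>R v) *v v)"
proof -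
  have dg: "(g has_derivative (\<lambda>h. grad g y \<bullet> h)) (at y)" for y
    using g by (intro has_derivative_grad) (simp add: twice_differentiable_def)
  have dh: "(grad g has_derivative (\<lambda>h. hess g y *v h)) (at y)" for y
    using g by (intro has_derivative_hess) (simp add: twice_differentiable_def)
  let ?p = "\<lambda>a. g (x + a *\<^sub>R u + v) - g (x + a *\<^sub>R u)"
  have "\<exists>a\<in>{0..1}. ?p 1 - ?p 0 = (\<lambda>a c. (grad g (x + a *\<^sub>R u + v) - grad g (x + a *\<^sub>R u)) \<bullet> (c *\<^sub>R u)) a (1 - 0)"
    by (rule mvt_very_simple)
      (auto intro!: derivative_eq_intros has_derivative_compose[OF _ dg] simp: inner_diff_left algebra_simps)
  then obtain a where a: "a \<in> {0..1}"
    "?p 1 - ?p 0 = (grad g (x + a *\<^sub>R u + v) - grad g (x + a *\<^sub>R u)) \<bullet> u" by auto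
  let ?q = "\<lambda>b. u \<bullet> grad g (x + a *\<^sub>R u + b *\<^sub>R v)"
  have "\<exists>b\<in>{0..1}. ?q 1 - ?q 0 = (\<lambda>b c. u \<bullet> (hess g (x + a *\<^sub>R u + b *\<^sub>R v) *v (c *\<^sub>R v))) b (1 - 0)"
    by (rule mvt_very_simple)
      (auto intro!: derivative_eq_intros has_derivative_compose[OF _ dh])
  then obtain b where b: "b \<in> {0..1}" "?q 1 - ?q 0 = u \<bullet> (hess g (x + a *\<^sub>R u + b *\<^sub>R v) *v v)" by auto
  have "g (x + u + v) - g (x + u) - g (x + v) + g x = ?p 1 - ?p 0" by simp
  also have "\<dots> = ?q 1 - ?q 0" using a(2) by (simp add: inner_commute inner_diff_left inner_diff_right)
  finally show ?thesis unfolding b(2) using a(1) b(1) by blast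
qed

text \<open>Schwarz's theorem: with increments u/n and v/n, the mixed second difference times n
  squared tends to the Hessian form in either order of the arguments, since the intermediate points
  converge to \<open>x\<close> and the Hessian is continuous there.\<close>

lemma transpose_hess:
  fixes g :: "real^'d \<Rightarrow> real"
  assumes "C2 g"
  shows "transpose (hess g x) = hess g x"
proof -
  have g: "twice_differentiable g" and cont: "continuous_on UNIV (hess g)"
    using assms by (auto simp: C2_def)
  have lim: "(\<lambda>n. ((1/real (Suc n)) *\<^sub>R u) \<bullet> (hess g (z n) *v ((1/real (Suc n)) *\<^sub>R v)) * (real (Suc n))\<^sup>2)
      \<longlonglongrightarrow> u \<bullet> (hess g x *v v)"
    if z: "\<And>n. \<exists>a\<in>{0..1}. \<exists>b\<in>{0..1}. z n = x + a *\<^sub>R ((1/real (Suc n)) *\<^sub>R u') + b *\<^sub>R ((1/real (Suc n)) *\<^sub>R v')"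
    for z u v u' v'
  proof -
    have "norm (z n - x) \<le> (norm u' + norm v') * (1 / real (Suc n))" for n
    proof -
      obtain a b where ab: "a \<in> {0..1}" "b \<in> {0..1}"
        "z n - x = (1/real (Suc n)) *\<^sub>R (a *\<^sub>R u' + b *\<^sub>R v')"
        using z[of n] by (auto simp: algebra_simps)
      have "norm (a *\<^sub>R u' + b *\<^sub>R v') \<le> norm u' + norm v'"
        using ab(1,2) by (intro norm_triangle_mono) (auto simp: mult_left_le_one_le)
      then show ?thesis unfolding ab(3) by (simp add: divide_right_mono)
    qed
    moreover have "(\<lambda>n. (norm u' + norm v') * (1 / real (Suc n))) \<longlonglongrightarrow> (norm u' + norm v') * 0"
      by (intro tendsto_mult tendsto_const LIMSEQ_one_over_Suc)
    ultimately have "(\<lambda>n. z n - x) \<longlonglongrightarrow> 0"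
      by (intro Lim_null_comparison[of "\<lambda>n. z n - x"]) auto
    then have "z \<longlonglongrightarrow> x" by (simp add: LIM_zero_iff)
    moreover have "isCont (hess g) x" using cont by (simp add: continuous_on_eq_continuous_at)
    ultimately have "(\<lambda>n. hess g (z n)) \<longlonglongrightarrow> hess g x"
      by (intro isCont_tendsto_compose[of x "hess g" z])
    then have "(\<lambda>n. u \<bullet> (hess g (z n) *v v)) \<longlonglongrightarrow> u \<bullet> (hess g x *v v)"
      by (intro tendsto_inner tendsto_const vec_tendstoI)
        (auto simp: matrix_vector_mult_def intro!: tendsto_intros)
    then show ?thesis
      by (simp add: matrix_vector_mult_scaleR power2_eq_square del: of_nat_Suc)
  qed
  have "u \<bullet> (hess g x *v v) = v \<bullet> (hess g x *v u)" for u v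
  proof -
    let ?u = "\<lambda>n. (1/real (Suc n)) *\<^sub>R u" and ?v = "\<lambda>n. (1/real (Suc n)) *\<^sub>R v"
    let ?D = "\<lambda>n. g (x + ?u n + ?v n) - g (x + ?u n) - g (x + ?v n) + g x"
    have "\<exists>z. (\<exists>a\<in>{0..1}. \<exists>b\<in>{0..1}. z = x + a *\<^sub>R ?u n + b *\<^sub>R ?v n) \<and>
        ?D n = ?u n \<bullet> (hess g z *v ?v n)" for n
      using second_difference_mvt[OF g, of x "?u n" "?v n"] by blast
    then obtain z1 where z1: "\<And>n. \<exists>a\<in>{0..1}. \<exists>b\<in>{0..1}. z1 n = x + a *\<^sub>R ?u n + b *\<^sub>R ?v n"
      "\<And>n. ?D n = ?u n \<bullet> (hess g (z1 n) *v ?v n)"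
      by metis
    have swap: "?D n = g (x + ?v n + ?u n) - g (x + ?v n) - g (x + ?u n) + g x" for n
      by (simp add: algebra_simps)
    have "\<exists>z. (\<exists>a\<in>{0..1}. \<exists>b\<in>{0..1}. z = x + a *\<^sub>R ?v n + b *\<^sub>R ?u n) \<and>
        ?D n = ?v n \<bullet> (hess g z *v ?u n)" for n
      unfolding swap using second_difference_mvt[OF g, of x "?v n" "?u n"] by blast
    then obtain z2 where z2: "\<And>n. \<exists>a\<in>{0..1}. \<exists>b\<in>{0..1}. z2 n = x + a *\<^sub>R ?v n + b *\<^sub>R ?u n"
      "\<And>n. ?D n = ?v n \<bullet> (hess g (z2 n) *v ?u n)"
      by metis
    show ?thesis
      using LIMSEQ_unique[OF lim[OF z1(1), of u v] lim[OF z2(1), of v u, folded z2(2), unfolded z1(2)]] .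
  qed
  then show ?thesis
    by (metis dot_lmul_matrix inner_commute matrix_eq vector_eq_rdot vector_transpose_matrix transpose_matrix_vector)
qed

lemma transpose_D2_transpose:
  assumes "\<And>k. C2 (\<lambda>\<xi>. F \<xi> $ k)"
  shows "transpose (D2_transpose F x P) = D2_transpose F x P"
proof -
  have "hess (\<lambda>\<xi>. F \<xi> $ k) x $ j $ i = hess (\<lambda>\<xi>. F \<xi> $ k) x $ i $ j" for i j k
    using arg_cong[OF transpose_hess[OF assms[of k], of x], of "\<lambda>M. M $ i $ j"]
    by (simp add: transpose_def)
  then show ?thesis by (simp add: D2_transpose_def transpose_def)
qed

section \<open>Taylor remainders, difference quotients and measurability of derivatives\<close>

text \<open>On the segment the derivative deviates from its value at \<open>x\<close> by at most
  \<open>L * norm (y - x)\<close>, so the mean value inequality suffices; it does not give the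
  factor 1/2 of Taylor's formula, which no estimate below asks for.\<close>

lemma second_order_remainder:
  fixes g :: "'a::real_normed_vector \<Rightarrow> 'b::real_normed_vector"
  assumes g: "\<And>y. (g has_derivative g' y) (at y)"
    and lip: "\<And>y z h. norm (g' y h - g' z h) \<le> L * norm (y - z) * norm h" and L: "0 \<le> L"
  shows "norm (g y - g x - g' x (y - x)) \<le> L * (norm (y - x))\<^sup>2"
proof -
  have "norm (g y - g x - g' x (y - x)) \<le> norm (y - x) * (L * norm (y - x))"
  proof (rule differentiable_bound_linearization[where S = "closed_segment x y"])
    fix z assume z: "z \<in> closed_segment x y"
    show "(g has_derivative g' z) (at z within closed_segment x y)"
      by (rule has_derivative_at_withinI[OF g])
    have "norm (z - x) \<le> norm (y - x)" using segment_bound1[OF z] by (simp add: norm_minus_commute)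
    then have "norm ((g' z - g' x) h) \<le> L * norm (y - x) * norm h" for h
      using lip[of z h x] L
      by (simp add: fun_diff_def) (meson mult_left_mono mult_right_mono norm_ge_zero order_trans)
    then show "onorm (g' z - g' x) \<le> L * norm (y - x)"
      using L by (intro onorm_bound) auto
  next
    show "x + t *\<^sub>R (y - x) \<in> closed_segment x y" if "t \<in> {0..1}" for t
      unfolding in_segment using that by (intro exI[of _ t]) (auto simp: algebra_simps)
  qed simp
  then show ?thesis by (simp add: power2_eq_square mult_ac)
qed

text \<open>Writing a derivative as the limit of a sequence is what transfers both bounds and
  measurability in time from a function to its derivative.\<close>

lemma difference_quotient_LIMSEQ:
  fixes g :: "'a::real_normed_vector \<Rightarrow> 'b::real_normed_vector"
  assumes "(g has_derivative D) (at x)"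
  shows "(\<lambda>n. real (Suc n) *\<^sub>R (g (x + (1 / real (Suc n)) *\<^sub>R h) - g x)) \<longlonglongrightarrow> D h"
proof -
  have lin: "linear D" using assms by (rule has_derivative_linear)
  have 1: "(\<lambda>n. (1 / real (Suc n)) *\<^sub>R h) \<longlonglongrightarrow> 0 *\<^sub>R h"
    by (intro tendsto_intros LIMSEQ_one_over_Suc)
  have "(\<lambda>n. real (Suc n) *\<^sub>R (g (x + (1 / real (Suc n)) *\<^sub>R h) - g x) - D h) \<longlonglongrightarrow> 0"
  proof (rule LIMSEQ_I)
    fix r :: real assume "r > 0"
    \<comment> \<open>The 1 in the denominator covers h = 0.\<close>
    define e where "e = r / (norm h + 1)"
    have e: "e > 0" using \<open>r > 0\<close> by (simp add: e_def add_nonneg_pos)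
    then obtain d where d: "d > 0" "\<And>y. norm (y - x) < d \<Longrightarrow> norm (g y - g x - D (y - x)) \<le> e * norm (y - x)"
      using assms unfolding has_derivative_at_alt by metis
    obtain N where N: "\<And>n. n \<ge> N \<Longrightarrow> norm ((1 / real (Suc n)) *\<^sub>R h) < d"
      using LIMSEQ_D[OF 1 d(1)] by auto
    have "norm (real (Suc n) *\<^sub>R (g (x + (1 / real (Suc n)) *\<^sub>R h) - g x) - D h) < r" if "n \<ge> N" for n
    proof -
      let ?s = "real (Suc n)" and ?k = "(1 / real (Suc n)) *\<^sub>R h"
      have "?s *\<^sub>R (g (x + ?k) - g x) - D h = ?s *\<^sub>R (g (x + ?k) - g x - D ?k)"
        by (simp add: linear_scale[OF lin] scaleR_diff_right del: of_nat_Suc)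
      also have "norm \<dots> \<le> ?s * (e * norm ?k)"
        using mult_left_mono[OF d(2)[of "x + ?k"], of ?s] N[OF that] by (simp del: of_nat_Suc)
      also have "\<dots> = e * norm h" by (simp del: of_nat_Suc)
      also have "\<dots> < r" using \<open>r > 0\<close> by (simp add: e_def pos_divide_less_eq add_nonneg_pos)
      finally show ?thesis .
    qed
    then show "\<exists>N. \<forall>n\<ge>N. norm (real (Suc n) *\<^sub>R (g (x + (1 / real (Suc n)) *\<^sub>R h) - g x) - D h - 0) < r"
      by auto
  qed
  then show ?thesis by (simp add: LIM_zero_iff)
qed

lemma has_derivative_norm_le_lipschitz:
  fixes g :: "'a::real_normed_vector \<Rightarrow> 'b::real_normed_vector"
  assumes g: "(g has_derivative D) (at x)" and lip: "\<And>y. norm (g y - g x) \<le> L * norm (y - x)"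
  shows "norm (D h) \<le> L * norm h"
proof (rule Lim_norm_ubound[OF _ difference_quotient_LIMSEQ[OF g]])
  have "norm (real (Suc n) *\<^sub>R (g (x + (1 / real (Suc n)) *\<^sub>R h) - g x)) \<le> L * norm h" for n
    using mult_left_mono[OF lip[of "x + (1 / real (Suc n)) *\<^sub>R h"], of "real (Suc n)"]
    by (simp del: of_nat_Suc)
  then show "\<forall>\<^sub>F n in sequentially. norm (real (Suc n) *\<^sub>R (g (x + (1 / real (Suc n)) *\<^sub>R h) - g x)) \<le> L * norm h"
    by simp
qed simp

text \<open>Continuity in the control parameter is assumed of \<open>f\<close> and
  \<open>\<Phi>\<close> themselves and not of their state derivatives, so measurability of the
  latter along a control is obtained as a limit of measurable difference quotients.\<close>

lemma borel_measurable_derivative: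
  fixes g :: "'t \<Rightarrow> 'a::real_normed_vector \<Rightarrow> 'b::euclidean_space"
  assumes g: "\<And>t. t \<in> space M \<Longrightarrow> (g t has_derivative D t) (at x)"
    and meas: "\<And>y. (\<lambda>t. g t y) \<in> borel_measurable M"
  shows "(\<lambda>t. D t h) \<in> borel_measurable M"
proof (rule borel_measurable_LIMSEQ_metric)
  show "(\<lambda>t. real (Suc n) *\<^sub>R (g t (x + (1 / real (Suc n)) *\<^sub>R h) - g t x)) \<in> borel_measurable M" for n
    by (intro borel_measurable_scaleR borel_measurable_const borel_measurable_diff meas)
  show "(\<lambda>n. real (Suc n) *\<^sub>R (g t (x + (1 / real (Suc n)) *\<^sub>R h) - g t x)) \<longlonglongrightarrow> D t h"
    if "t \<in> space M" for t
    by (rule difference_quotient_LIMSEQ[OF g[OF that]])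
qed

lemma borel_measurable_vecI:
  fixes f :: "'t \<Rightarrow> 'a::euclidean_space^'n"
  assumes "\<And>i. (\<lambda>t. f t $ i) \<in> borel_measurable M"
  shows "f \<in> borel_measurable M"
  by (subst borel_measurable_euclidean_space)
    (auto simp: Basis_vec_def inner_axis intro!: borel_measurable_inner assms)

lemma borel_measurable_matrixI:
  fixes A :: "'t \<Rightarrow> real^'n^'m"
  assumes "\<And>h. (\<lambda>t. A t *v h) \<in> borel_measurable M"
  shows "A \<in> borel_measurable M"
proof (intro borel_measurable_vecI)
  fix i j
  have "(\<lambda>t. (A t *v axis j 1) \<bullet> axis i 1) \<in> borel_measurable M"
    by (intro borel_measurable_inner assms borel_measurable_const)
  then show "(\<lambda>t. A t $ i $ j) \<in> borel_measurable M"
    by (simp add: inner_axis matrix_vector_mul_component inner_axis')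
qed

lemma continuous_on_matrix_vector_mult [continuous_intros]:
  fixes A :: "'t::topological_space \<Rightarrow> real^'n^'m"
  shows "continuous_on S A \<Longrightarrow> continuous_on S x \<Longrightarrow> continuous_on S (\<lambda>t. A t *v x t)"
  unfolding matrix_vector_mult_def by (intro continuous_intros)

lemma continuous_on_transpose [continuous_intros]:
  fixes A :: "'t::topological_space \<Rightarrow> real^'n^'m"
  shows "continuous_on S A \<Longrightarrow> continuous_on S (\<lambda>t. transpose (A t))"
  unfolding transpose_def by (intro continuous_intros)

lemma borel_measurable_matrix_vector_mult:
  fixes A :: "'t \<Rightarrow> real^'n^'m"
  assumes "A \<in> borel_measurable M" "x \<in> borel_measurable M"
  shows "(\<lambda>t. A t *v x t) \<in> borel_measurable M"
  by (rule borel_measurable_continuous_Pair[OF assms, of "\<lambda>A x. A *v x"])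
    (intro continuous_intros)

text \<open>The increment over a unit step is compared with its linearisation.\<close>

lemma bounded_lipschitz_derivative_bound:
  fixes g :: "'a::real_normed_vector \<Rightarrow> 'b::real_normed_vector"
  assumes g: "\<And>y. (g has_derivative g' y) (at y)"
    and lip: "\<And>y z h. norm (g' y h - g' z h) \<le> L * norm (y - z) * norm h" and L: "0 \<le> L"
    and M: "\<And>y. norm (g y) \<le> M"
  shows "norm (g' x h) \<le> (2 * M + L) * norm h"
proof (cases "h = 0")
  case True
  then show ?thesis using linear_0[OF has_derivative_linear[OF g]] by simp
next
  case False
  define k where "k = (1 / norm h) *\<^sub>R h"
  have k: "norm k = 1" "h = norm h *\<^sub>R k" using False by (auto simp: k_def)
  have "norm (g (x + k) - g x - g' x k) \<le> L"
    using second_order_remainder[OF g lip L, of "x + k" x] k(1) by simp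
  moreover have "norm (g (x + k)) \<le> M" "norm (g x) \<le> M" using M by auto
  ultimately have "norm (g' x k) \<le> 2 * M + L"
    by norm
  moreover have "norm (g' x h) = norm h * norm (g' x k)"
    using linear_scale[OF has_derivative_linear[OF g], of x "norm h" k] k(2) by (metis abs_norm_cancel norm_scaleR)
  ultimately show ?thesis by (simp add: mult_left_mono mult.commute)
qed

section \<open>Differentiability of the value along a controlled flow\<close>

lemma absolutely_integrable_bounded_by_continuous:
  fixes u :: "real \<Rightarrow> 'a::euclidean_space"
  assumes "u \<in> borel_measurable (lebesgue_on {0..T})" "continuous_on {0..T} b"
    and "\<And>s. s \<in> {0..T} \<Longrightarrow> norm (u s) \<le> b s"
  shows "u absolutely_integrable_on {0..T}"
  by (rule measurable_bounded_by_integrable_imp_absolutely_integrable[where g = b])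
    (use assms integrable_continuous_real in auto)

lemma absolutely_integrable_add:
  fixes u v :: "real \<Rightarrow> 'a::euclidean_space"
  shows "u absolutely_integrable_on S \<Longrightarrow> v absolutely_integrable_on S
    \<Longrightarrow> (\<lambda>s. u s + v s) absolutely_integrable_on S"
  by (rule set_integral_add(1))

lemma has_derivative_of_quadratic_remainder:
  fixes f :: "'a::euclidean_space \<Rightarrow> 'b::real_normed_vector"
  assumes D: "linear D" and rem: "\<And>y. norm (f y - f x - D (y - x)) \<le> C * (norm (y - x))\<^sup>2"
  shows "(f has_derivative D) (at x)"
  unfolding has_derivative_at_alt
proof (intro conjI allI impI)
  show "bounded_linear D" using D by (simp add: linear_conv_bounded_linear)
  fix e :: real assume e: "e > 0"
  let ?d = "e / (\<bar>C\<bar> + 1)"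
  have "norm (f y - f x - D (y - x)) \<le> e * norm (y - x)" if "norm (y - x) < ?d" for y
  proof -
    have "C * norm (y - x) \<le> (\<bar>C\<bar> + 1) * norm (y - x)" by (intro mult_right_mono) auto
    also have "\<dots> \<le> e" using that by (simp add: field_simps)
    finally have "C * norm (y - x) * norm (y - x) \<le> e * norm (y - x)" by (intro mult_right_mono) auto
    then show ?thesis using rem[of y] by (simp add: power2_eq_square mult.assoc)
  qed
  moreover have "?d > 0" using e by (simp add: add_nonneg_pos)
  ultimately show "\<exists>d>0. \<forall>y. norm (y - x) < d \<longrightarrow> norm (f y - f x - D (y - x)) \<le> e * norm (y - x)"
    by blast
qed

text \<open>Covers the equations of P, \<beta> and \<alpha> at once: each is linear with a bounded
  coefficient and an integrable forcing term.\<close>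

lemma linear_field_integrable_lipschitz:
  fixes B :: "real \<Rightarrow> real^'n^'n"
  assumes B: "B \<in> borel_measurable (lebesgue_on {0..T})"
    and bound: "\<And>s. s \<in> {0..T} \<Longrightarrow> norm (B s) \<le> K" and K: "0 \<le> K"
    and b: "b absolutely_integrable_on {0..T}"
  shows "integrable_lipschitz_field T K (\<lambda>s y. B s *v y + b s)"
  unfolding integrable_lipschitz_field_def
proof (intro conjI allI impI ballI)
  fix y :: "real \<Rightarrow> real^'n" assume y: "continuous_on {0..T} y"
  have "(\<lambda>s. B s *v y s) absolutely_integrable_on {0..T}"
  proof (rule absolutely_integrable_bounded_by_continuous)
    show "(\<lambda>s. B s *v y s) \<in> borel_measurable (lebesgue_on {0..T})"
      by (rule borel_measurable_matrix_vector_mult[OF B continuous_imp_measurable_on_sets_lebesgue[OF y]]) simp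
    show "continuous_on {0..T} (\<lambda>s. K * norm (y s))" by (intro continuous_intros y)
    show "norm (B s *v y s) \<le> K * norm (y s)" if "s \<in> {0..T}" for s
      using norm_matrix_vector_mult_le[of "B s" "y s"] bound[OF that]
      by (meson mult_right_mono norm_ge_zero order_trans)
  qed
  then show "(\<lambda>s. B s *v y s + b s) absolutely_integrable_on {0..T}"
    using b by (rule absolutely_integrable_add)
next
  fix s y z assume s: "s \<in> {0..T}"
  have "norm (B s *v (y - z)) \<le> K * norm (y - z)"
    using norm_matrix_vector_mult_le[of "B s" "y - z"] bound[OF s]
    by (meson mult_right_mono norm_ge_zero order_trans)
  then show "norm (B s *v y + b s - (B s *v z + b s)) \<le> K * norm (y - z)"
    by (simp add: matrix_vector_mult_diff_distrib)
qed (rule K)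

section \<open>Data and integrability for one fixed control\<close>

text \<open>The control is absorbed into the time dependence: \<open>F\<close> is the dynamics with
  Jacobian \<open>A\<close>, \<open>c\<close> the running cost with gradient \<open>g\<close>, and
  \<open>gl\<close>, \<open>hl\<close> are gradient and Hessian of the terminal cost.
  \<open>S\<close> is minus the state derivative of the costate right-hand side at a frozen costate,
  the sign with which it enters the equation of \<alpha>.\<close>

locale controlled_flow =
  fixes T M K L :: real
    and F :: "real \<Rightarrow> real^'d \<Rightarrow> real^'d" and A :: "real \<Rightarrow> real^'d \<Rightarrow> real^'d^'d"
    and c :: "real \<Rightarrow> real^'d \<Rightarrow> real" and g :: "real \<Rightarrow> real^'d \<Rightarrow> real^'d"
    and S :: "real \<Rightarrow> real^'d \<Rightarrow> real^'d \<Rightarrow> real^'d^'d"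
    and l :: "real^'d \<Rightarrow> real" and gl :: "real^'d \<Rightarrow> real^'d" and hl :: "real^'d \<Rightarrow> real^'d^'d"
  assumes T: "0 < T" and K: "0 \<le> K" and L: "0 \<le> L"
    and F_meas: "\<And>\<xi>. (\<lambda>t. F t \<xi>) \<in> borel_measurable (lebesgue_on {0..T})"
    and F_bound: "\<And>t \<xi>. t \<in> {0..T} \<Longrightarrow> norm (F t \<xi>) \<le> M"
    and F_deriv: "\<And>t \<xi>. t \<in> {0..T} \<Longrightarrow> (F t has_derivative (\<lambda>h. A t \<xi> *v h)) (at \<xi>)"
    and A_bound: "\<And>t \<xi>. t \<in> {0..T} \<Longrightarrow> norm (A t \<xi>) \<le> K"
    and A_lip: "\<And>t \<xi> \<eta>. t \<in> {0..T} \<Longrightarrow> norm (A t \<xi> - A t \<eta>) \<le> L * norm (\<xi> - \<eta>)"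
    and c_abs: "\<And>\<xi>. (\<lambda>t. c t \<xi>) absolutely_integrable_on {0..T}"
    and c_deriv: "\<And>t \<xi>. t \<in> {0..T} \<Longrightarrow> (c t has_derivative (\<lambda>h. g t \<xi> \<bullet> h)) (at \<xi>)"
    and g_lip: "\<And>t \<xi> \<eta>. t \<in> {0..T} \<Longrightarrow> norm (g t \<xi> - g t \<eta>) \<le> L * norm (\<xi> - \<eta>)"
    and S_deriv: "\<And>t \<xi> \<pi>. t \<in> {0..T} \<Longrightarrow>
      ((\<lambda>\<xi>. g t \<xi> - transpose (A t \<xi>) *v \<pi>) has_derivative (\<lambda>h. - (S t \<xi> \<pi> *v h))) (at \<xi>)"
    and S_cont: "\<And>t. t \<in> {0..T} \<Longrightarrow> continuous_on UNIV (\<lambda>z. S t (fst z) (snd z))"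
    and l_deriv: "\<And>\<xi>. (l has_derivative (\<lambda>h. gl \<xi> \<bullet> h)) (at \<xi>)"
    and gl_lip: "\<And>\<xi> \<eta>. norm (gl \<xi> - gl \<eta>) \<le> L * norm (\<xi> - \<eta>)"
    and gl_deriv: "\<And>\<xi>. (gl has_derivative (\<lambda>h. hl \<xi> *v h)) (at \<xi>)"
begin

abbreviation "time_measure \<equiv> lebesgue_on {0..T}"

lemma A_meas: "(\<lambda>t. A t \<xi>) \<in> borel_measurable time_measure"
proof (rule borel_measurable_matrixI)
  show "(\<lambda>t. A t \<xi> *v h) \<in> borel_measurable time_measure" for h
    by (rule borel_measurable_derivative[where g = F and x = \<xi>, OF _ F_meas]) (use F_deriv in simp)
qed

lemma g_meas: "(\<lambda>t. g t \<xi>) \<in> borel_measurable time_measure"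
proof (intro borel_measurable_vecI)
  fix i
  have "(\<lambda>t. g t \<xi> \<bullet> axis i 1) \<in> borel_measurable time_measure"
    by (rule borel_measurable_derivative[where g = c and x = \<xi>])
      (use c_deriv in \<open>auto intro!: absolutely_integrable_imp_borel_measurable c_abs\<close>)
  then show "(\<lambda>t. g t \<xi> $ i) \<in> borel_measurable time_measure" by (simp add: inner_axis)
qed

lemma A_cont: "t \<in> {0..T} \<Longrightarrow> continuous_on UNIV (A t)"
  using A_lip[of t] L by (intro lipschitz_on_continuous_on[of L] lipschitz_onI) (auto simp: dist_norm)

lemma g_cont: "t \<in> {0..T} \<Longrightarrow> continuous_on UNIV (g t)"
  using g_lip[of t] L by (intro lipschitz_on_continuous_on[of L] lipschitz_onI) (auto simp: dist_norm)

text \<open>The constant grows with the norm of the costate because the transposed Jacobian acts on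
  it linearly. Along a solution this is harmless, a costate being continuous on a compact
  interval.\<close>

lemma costate_field_lip:
  assumes t: "t \<in> {0..T}"
  shows "norm ((g t \<xi> - transpose (A t \<xi>) *v \<pi>) - (g t \<eta> - transpose (A t \<eta>) *v \<pi>))
    \<le> L * (1 + norm \<pi>) * norm (\<xi> - \<eta>)"
proof -
  have "norm (transpose (A t \<xi> - A t \<eta>) *v \<pi>) \<le> L * norm (\<xi> - \<eta>) * norm \<pi>"
    using norm_matrix_vector_mult_le[of "transpose (A t \<xi> - A t \<eta>)" \<pi>] A_lip[OF t, of \<xi> \<eta>]
    by (simp add: norm_transpose) (meson mult_right_mono norm_ge_zero order_trans)
  moreover have "(g t \<xi> - transpose (A t \<xi>) *v \<pi>) - (g t \<eta> - transpose (A t \<eta>) *v \<pi>)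
      = (g t \<xi> - g t \<eta>) - transpose (A t \<xi> - A t \<eta>) *v \<pi>"
    by (simp add: transpose_def vec_eq_iff matrix_vector_mult_def sum_subtractf left_diff_distrib)
  ultimately show ?thesis
    using g_lip[OF t, of \<xi> \<eta>] norm_triangle_ineq4[of "g t \<xi> - g t \<eta>" "transpose (A t \<xi> - A t \<eta>) *v \<pi>"]
    by (simp add: algebra_simps)
qed

text \<open>The derivative of a Lipschitz map is bounded by the Lipschitz constant; this is how
  second derivatives are bounded here, their continuity giving nothing uniform in time.\<close>

lemma S_bound: "t \<in> {0..T} \<Longrightarrow> norm (S t \<xi> \<pi> *v h) \<le> L * (1 + norm \<pi>) * norm h"
  using has_derivative_norm_le_lipschitz[OF S_deriv costate_field_lip] by simp

lemma S_meas: "(\<lambda>t. S t \<xi> \<pi>) \<in> borel_measurable time_measure"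
proof (rule borel_measurable_matrixI)
  fix h
  have "(\<lambda>t. - (S t \<xi> \<pi> *v h)) \<in> borel_measurable time_measure"
  proof (rule borel_measurable_derivative[where g = "\<lambda>t \<xi>. g t \<xi> - transpose (A t \<xi>) *v \<pi>" and x = \<xi>])
    have "continuous_on UNIV (\<lambda>A :: real^'d^'d. transpose A *v \<pi>)" by (intro continuous_intros)
    from borel_measurable_continuous_on[OF this A_meas]
    show "(\<lambda>t. g t \<eta> - transpose (A t \<eta>) *v \<pi>) \<in> borel_measurable time_measure" for \<eta>
      by (intro borel_measurable_diff g_meas)
  qed (use S_deriv in simp)
  then show "(\<lambda>t. S t \<xi> \<pi> *v h) \<in> borel_measurable time_measure"
    using borel_measurable_uminus by fastforce
qed

lemma A_along_meas: "continuous_on {0..T} X \<Longrightarrow> (\<lambda>s. A s (X s)) \<in> borel_measurable time_measure"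
  by (rule borel_measurable_caratheodory_interval[OF A_meas A_cont])

lemma transpose_A_along_meas:
  assumes "continuous_on {0..T} X"
  shows "(\<lambda>s. - transpose (A s (X s))) \<in> borel_measurable time_measure"
proof -
  have "continuous_on UNIV (\<lambda>A :: real^'d^'d. - transpose A)" by (intro continuous_intros)
  from borel_measurable_continuous_on[OF this A_along_meas[OF assms]] show ?thesis .
qed

lemma c_taylor:
  assumes t: "t \<in> {0..T}"
  shows "norm (c t \<eta> - c t \<xi> - g t \<xi> \<bullet> (\<eta> - \<xi>)) \<le> L * (norm (\<eta> - \<xi>))\<^sup>2"
proof (rule second_order_remainder[OF c_deriv[OF t] _ L])
  fix y z h :: "real^'d"
  have "norm (g t y - g t z) * norm h \<le> L * norm (y - z) * norm h"
    by (intro mult_right_mono g_lip[OF t]) auto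
  then show "norm (g t y \<bullet> h - g t z \<bullet> h) \<le> L * norm (y - z) * norm h"
    using Cauchy_Schwarz_ineq2[of "g t y - g t z" h] by (simp add: inner_diff_left)
qed

lemma l_taylor: "norm (l \<eta> - l \<xi> - gl \<xi> \<bullet> (\<eta> - \<xi>)) \<le> L * (norm (\<eta> - \<xi>))\<^sup>2"
proof (rule second_order_remainder[OF l_deriv _ L])
  fix y z h :: "real^'d"
  have "norm (gl y - gl z) * norm h \<le> L * norm (y - z) * norm h"
    by (intro mult_right_mono gl_lip) auto
  then show "norm (gl y \<bullet> h - gl z \<bullet> h) \<le> L * norm (y - z) * norm h"
    using Cauchy_Schwarz_ineq2[of "gl y - gl z" h] by (simp add: inner_diff_left)
qed

lemma F_taylor:
  assumes t: "t \<in> {0..T}"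
  shows "norm (F t \<eta> - F t \<xi> - A t \<xi> *v (\<eta> - \<xi>)) \<le> L * (norm (\<eta> - \<xi>))\<^sup>2"
proof (rule second_order_remainder[OF F_deriv[OF t] _ L])
  fix y z h :: "real^'d"
  have "norm (A t y - A t z) * norm h \<le> L * norm (y - z) * norm h"
    by (intro mult_right_mono A_lip[OF t]) auto
  then show "norm (A t y *v h - A t z *v h) \<le> L * norm (y - z) * norm h"
    using norm_matrix_vector_mult_le[of "A t y - A t z" h] by (simp add: matrix_vector_mult_diff_rdistrib)
qed

lemma A_mult_bound: "t \<in> {0..T} \<Longrightarrow> norm (A t \<xi> *v y) \<le> K * norm y"
  using norm_matrix_vector_mult_le[of "A t \<xi>" y] A_bound[of t \<xi>]
  by (meson mult_right_mono norm_ge_zero order_trans)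

lemma transpose_A_mult_bound: "t \<in> {0..T} \<Longrightarrow> norm (transpose (A t \<xi>) *v y) \<le> K * norm y"
  using norm_matrix_vector_mult_le[of "transpose (A t \<xi>)" y] A_bound[of t \<xi>]
  by (simp add: norm_transpose) (meson mult_right_mono norm_ge_zero order_trans)

lemma F_lip: 
  assumes "t \<in> {0..T}"
  shows "norm (F t \<xi> - F t \<eta>) \<le> K * norm (\<xi> - \<eta>)"
proof (rule differentiable_bound[of UNIV])
  show "onorm (\<lambda>h. A t x *v h) \<le> K" for x
    using K A_mult_bound[OF assms] by (intro onorm_bound)
qed (use F_deriv[OF assms] in auto)

text \<open>By the Taylor estimate at 0, each component of \<open>g s 0\<close> differs from
  \<open>c s (axis i 1) - c s 0\<close> by at most L, so integrability of the cost at finitely many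
  frozen states bounds the gradient at 0; the Lipschitz condition extends this along the
  curve.\<close>

lemma g_along_abs:
  assumes X: "continuous_on {0..T} X"
  shows "(\<lambda>s. g s (X s)) absolutely_integrable_on {0..T}"
proof (rule measurable_bounded_by_integrable_imp_absolutely_integrable)
  let ?b = "\<lambda>s. (\<Sum>i\<in>(UNIV::'d set). norm (c s (axis i 1)) + norm (c s 0) + L) + L * norm (X s)"
  show "(\<lambda>s. g s (X s)) \<in> borel_measurable time_measure"
    by (rule borel_measurable_caratheodory_interval[OF g_meas g_cont X])
  have "(\<lambda>s. norm (c s \<xi>)) integrable_on {0..T}" for \<xi>
    using c_abs[of \<xi>] by (simp add: absolutely_integrable_on_def)
  note norm_c = this
  show "?b integrable_on {0..T}"
  proof (intro integrable_add integrable_sum norm_c)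
    show "(\<lambda>s. L * norm (X s)) integrable_on {0..T}"
      by (intro integrable_continuous_real continuous_intros X)
  qed auto
  fix s assume s: "s \<in> {0..T}"
  have "\<bar>g s 0 $ i\<bar> \<le> norm (c s (axis i 1)) + norm (c s 0) + L" for i
    using c_taylor[OF s, of "axis i 1" 0] by (simp add: inner_axis)
  then have "norm (g s 0) \<le> (\<Sum>i\<in>(UNIV::'d set). norm (c s (axis i 1)) + norm (c s 0) + L)"
    by (intro order_trans[OF norm_le_l1_cart] sum_mono)
  moreover have "norm (g s (X s)) \<le> norm (g s 0) + L * norm (X s)"
    using g_lip[OF s, of "X s" 0] norm_triangle_ineq2[of "g s (X s)" "g s 0"] by simp
  ultimately show "norm (g s (X s)) \<le> ?b s" by simp
qed simp

text \<open>The Taylor expansion at the state 0 gives the majorant: its linear term is an integrable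
  function times a bounded one, its quadratic term is continuous.\<close>

lemma c_along_abs:
  assumes X: "continuous_on {0..T} X"
  shows "(\<lambda>s. c s (X s)) absolutely_integrable_on {0..T}"
proof (rule measurable_bounded_by_integrable_imp_absolutely_integrable)
  let ?b = "\<lambda>s. norm (c s 0) + norm (g s 0) * norm (X s) + L * (norm (X s))\<^sup>2"
  show "(\<lambda>s. c s (X s)) \<in> borel_measurable time_measure"
  proof (rule borel_measurable_caratheodory_interval[OF _ _ X])
    show "(\<lambda>t. c t \<xi>) \<in> borel_measurable time_measure" for \<xi>
      by (rule absolutely_integrable_imp_borel_measurable[OF c_abs]) simp
    show "continuous_on UNIV (c t)" if "t \<in> {0..T}" for t
      by (simp add: continuous_on_eq_continuous_at has_derivative_continuous[OF c_deriv[OF that]])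
  qed
  have "(\<lambda>s. norm (X s) * norm (g s 0)) absolutely_integrable_on {0..T}"
  proof (rule absolutely_integrable_bounded_measurable_product_real)
    have nX: "continuous_on {0..T} (\<lambda>s. norm (X s))" by (intro continuous_intros X)
    show "(\<lambda>s. norm (X s)) \<in> borel_measurable time_measure"
      by (rule continuous_imp_measurable_on_sets_lebesgue[OF nX]) simp
    show "bounded ((\<lambda>s. norm (X s)) ` {0..T})"
      by (intro compact_imp_bounded compact_continuous_image nX) simp
    show "(\<lambda>s. norm (g s 0)) absolutely_integrable_on {0..T}"
      using absolutely_integrable_norm[OF g_along_abs[of "\<lambda>_. 0"]] by (simp add: o_def)
  qed simp
  note gX = this
  show "?b integrable_on {0..T}"
  proof (intro integrable_add)
    show "(\<lambda>s. norm (c s 0)) integrable_on {0..T}"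
      using c_abs[of 0] by (simp add: absolutely_integrable_on_def)
    show "(\<lambda>s. L * (norm (X s))\<^sup>2) integrable_on {0..T}"
      by (intro integrable_continuous_real continuous_intros X)
  qed (use gX in \<open>simp add: absolutely_integrable_on_def mult.commute\<close>)
  fix s assume s: "s \<in> {0..T}"
  show "norm (c s (X s)) \<le> ?b s"
    using c_taylor[OF s, of "X s" 0] Cauchy_Schwarz_ineq2[of "g s 0" "X s"] by simp
qed simp

lemma S_along_abs:
  assumes X: "continuous_on {0..T} X" and P: "continuous_on {0..T} P" and B: "continuous_on {0..T} B"
  shows "(\<lambda>s. S s (X s) (P s) *v B s) absolutely_integrable_on {0..T}"
proof (rule absolutely_integrable_bounded_by_continuous)
  have "(\<lambda>s. S s (fst (X s, P s)) (snd (X s, P s))) \<in> borel_measurable time_measure"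
    by (rule borel_measurable_caratheodory_interval[where H = "\<lambda>s z. S s (fst z) (snd z)"])
      (auto intro!: S_meas S_cont continuous_intros X P)
  then show "(\<lambda>s. S s (X s) (P s) *v B s) \<in> borel_measurable time_measure"
    by (intro borel_measurable_matrix_vector_mult continuous_imp_measurable_on_sets_lebesgue[OF B]) simp_all
  show "continuous_on {0..T} (\<lambda>s. L * (1 + norm (P s)) * norm (B s))"
    by (intro continuous_intros P B)
qed (rule S_bound)

section \<open>Existence and uniqueness for the four equations\<close>

definition is_state :: "real^'d \<Rightarrow> (real \<Rightarrow> real^'d) \<Rightarrow> bool" where
  "is_state x X \<longleftrightarrow> primitive_on T (\<lambda>s. F s (X s)) X \<and> X 0 = x"

definition is_costate :: "(real \<Rightarrow> real^'d) \<Rightarrow> (real \<Rightarrow> real^'d) \<Rightarrow> bool" where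
  "is_costate X P \<longleftrightarrow>
     primitive_on T (\<lambda>s. - (transpose (A s (X s)) *v P s) + g s (X s)) P \<and> P T = - gl (X T)"

definition is_tangent :: "(real \<Rightarrow> real^'d) \<Rightarrow> real^'d \<Rightarrow> (real \<Rightarrow> real^'d) \<Rightarrow> bool" where
  "is_tangent X h B \<longleftrightarrow> primitive_on T (\<lambda>s. A s (X s) *v B s) B \<and> B 0 = h"

definition is_second ::
  "(real \<Rightarrow> real^'d) \<Rightarrow> (real \<Rightarrow> real^'d) \<Rightarrow> (real \<Rightarrow> real^'d) \<Rightarrow> (real \<Rightarrow> real^'d) \<Rightarrow> bool" where
  "is_second X P B \<alpha> \<longleftrightarrow>
     primitive_on T (\<lambda>s. - (transpose (A s (X s)) *v \<alpha> s) + S s (X s) (P s) *v B s) \<alpha> \<and>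
     \<alpha> T = hl (X T) *v B T"

lemma is_state_cont: "is_state x X \<Longrightarrow> continuous_on {0..T} X"
  and is_costate_cont: "is_costate X P \<Longrightarrow> continuous_on {0..T} P"
  and is_tangent_cont: "is_tangent X h B \<Longrightarrow> continuous_on {0..T} B"
  by (auto simp: is_state_def is_costate_def is_tangent_def intro: primitive_on_continuous)

lemma uminus_matrix_vector_mult: "- C *v x = - (C *v x)" for C :: "real^'d^'d"
  by (simp add: vec_eq_iff matrix_vector_mult_def sum_negf)

lemma state_exists: "\<exists>X. is_state x X"
  unfolding is_state_def
proof (rule caratheodory_solution_exists)
  show "integrable_lipschitz_field T K F"
    unfolding integrable_lipschitz_field_def
  proof (intro conjI allI impI ballI)
    fix y :: "real \<Rightarrow> real^'d" assume y: "continuous_on {0..T} y"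
    show "(\<lambda>s. F s (y s)) absolutely_integrable_on {0..T}"
    proof (rule absolutely_integrable_bounded_by_continuous[where b = "\<lambda>_. M"])
      have "continuous_on UNIV (F t)" if "t \<in> {0..T}" for t
        by (simp add: continuous_on_eq_continuous_at has_derivative_continuous[OF F_deriv[OF that]])
      then show "(\<lambda>s. F s (y s)) \<in> borel_measurable time_measure"
        by (intro borel_measurable_caratheodory_interval[OF F_meas _ y])
    qed (use F_bound in auto)
  qed (use K F_lip in auto)
qed (use T in simp)

lemma costate_exists:
  assumes X: "continuous_on {0..T} X"
  shows "\<exists>P. is_costate X P"
  using caratheodory_solution_exists_backward[OF linear_field_integrable_lipschitz[OF
        transpose_A_along_meas[OF X] _ K g_along_abs[OF X]], of "- gl (X T)"] T A_bound
  by (simp add: is_costate_def norm_transpose uminus_matrix_vector_mult)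

lemma tangent_exists:
  assumes X: "continuous_on {0..T} X"
  shows "\<exists>B. is_tangent X h B"
  using caratheodory_solution_exists[OF linear_field_integrable_lipschitz[OF
        A_along_meas[OF X] _ K, of "\<lambda>_. 0"], of h] T A_bound
  by (simp add: is_tangent_def)

lemma second_exists:
  assumes X: "continuous_on {0..T} X" and P: "continuous_on {0..T} P" and B: "continuous_on {0..T} B"
  shows "\<exists>\<alpha>. is_second X P B \<alpha>"
  using caratheodory_solution_exists_backward[OF linear_field_integrable_lipschitz[OF
        transpose_A_along_meas[OF X] _ K S_along_abs[OF X P B]], of "hl (X T) *v B T"] T A_bound
  by (simp add: is_second_def norm_transpose uminus_matrix_vector_mult)

lemma state_unique: "is_state x X \<Longrightarrow> is_state x Y \<Longrightarrow> t \<in> {0..T} \<Longrightarrow> X t = Y t"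
  unfolding is_state_def using primitive_on_unique[of T F X Y K t] F_lip K by auto

text \<open>The two state curves are compared on \<open>{0..T}\<close> only, being arbitrary
  elsewhere. There \<open>Q\<close> also solves the equation driven by \<open>X\<close>, which
  reduces the claim to uniqueness for one field with equal terminal values.\<close>

lemma costate_unique:
  assumes X: "\<And>t. t \<in> {0..T} \<Longrightarrow> X t = Y t" and P: "is_costate X P" and Q: "is_costate Y Q"
    and t: "t \<in> {0..T}"
  shows "P t = Q t"
proof (rule primitive_on_unique[OF _ _ _ K _ t])
  let ?F = "\<lambda>s y. - (transpose (A s (X s)) *v y) + g s (X s)"
  show "primitive_on T (\<lambda>s. ?F s (P s)) P" using P by (simp add: is_costate_def)
  show "primitive_on T (\<lambda>s. ?F s (Q s)) Q"
    by (rule primitive_on_cong[OF conjunct1[OF Q[unfolded is_costate_def]]]) (use T X in auto)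
  show "norm (?F s y - ?F s z) \<le> K * norm (y - z)" if "s \<in> {0..T}" for s y z
    using transpose_A_mult_bound[OF that, of "X s" "z - y"]
    by (simp add: matrix_vector_mult_diff_distrib norm_minus_commute)
  show "P 0 = Q 0 \<or> P T = Q T" using P Q X[of T] T by (simp add: is_costate_def)
qed

lemma tangent_unique:
  assumes X: "\<And>t. t \<in> {0..T} \<Longrightarrow> X t = Y t" and B: "is_tangent X h B" and C: "is_tangent Y h C"
    and t: "t \<in> {0..T}"
  shows "B t = C t"
proof (rule primitive_on_unique[OF _ _ _ K _ t])
  let ?F = "\<lambda>s y. A s (X s) *v y"
  show "primitive_on T (\<lambda>s. ?F s (B s)) B" using B by (simp add: is_tangent_def)
  show "primitive_on T (\<lambda>s. ?F s (C s)) C"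
    by (rule primitive_on_cong[OF conjunct1[OF C[unfolded is_tangent_def]]]) (use T X in auto)
  show "norm (?F s y - ?F s z) \<le> K * norm (y - z)" if "s \<in> {0..T}" for s y z
    using A_mult_bound[OF that, of "X s" "y - z"]
    by (simp add: matrix_vector_mult_diff_distrib)
  show "B 0 = C 0 \<or> B T = C T" using B C by (simp add: is_tangent_def)
qed

lemma second_unique:
  assumes X: "\<And>t. t \<in> {0..T} \<Longrightarrow> X t = Y t" and P: "\<And>t. t \<in> {0..T} \<Longrightarrow> P t = Q t"
    and B: "\<And>t. t \<in> {0..T} \<Longrightarrow> B t = C t"
    and \<alpha>: "is_second X P B \<alpha>" and \<gamma>: "is_second Y Q C \<gamma>"
    and t: "t \<in> {0..T}"
  shows "\<alpha> t = \<gamma> t"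
proof (rule primitive_on_unique[OF _ _ _ K _ t])
  let ?F = "\<lambda>s y. - (transpose (A s (X s)) *v y) + S s (X s) (P s) *v B s"
  show "primitive_on T (\<lambda>s. ?F s (\<alpha> s)) \<alpha>" using \<alpha> by (simp add: is_second_def)
  show "primitive_on T (\<lambda>s. ?F s (\<gamma> s)) \<gamma>"
    by (rule primitive_on_cong[OF conjunct1[OF \<gamma>[unfolded is_second_def]]]) (use T X P B in auto)
  show "norm (?F s y - ?F s z) \<le> K * norm (y - z)" if "s \<in> {0..T}" for s y z
    using transpose_A_mult_bound[OF that, of "X s" "z - y"]
    by (simp add: matrix_vector_mult_diff_distrib norm_minus_commute)
  show "\<alpha> 0 = \<gamma> 0 \<or> \<alpha> T = \<gamma> T" using \<alpha> \<gamma> X[of T] B[of T] T by (simp add: is_second_def)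
qed

end

section \<open>First derivative in the initial value\<close>

context controlled_flow
begin

text \<open>The choice is the same as in \<open>trajectory\<close>, so that the two coincide as
  functions on the whole line.\<close>

definition flow :: "real^'d \<Rightarrow> real \<Rightarrow> real^'d" where
  "flow x = (SOME X. is_state x X)"

definition costate :: "real^'d \<Rightarrow> real \<Rightarrow> real^'d" where
  "costate x = (SOME P. is_costate (flow x) P)"

definition tangent :: "real^'d \<Rightarrow> real^'d \<Rightarrow> real \<Rightarrow> real^'d" where
  "tangent x h = (SOME B. is_tangent (flow x) h B)"

text \<open>With \<open>tangent x h\<close> the directional derivative of the flow along
  \<open>h\<close>, this turns out to be minus the directional derivative of the costate.\<close>

definition second :: "real^'d \<Rightarrow> real^'d \<Rightarrow> real \<Rightarrow> real^'d" where
  "second x h = (SOME \<alpha>. is_second (flow x) (costate x) (tangent x h) \<alpha>)"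

definition total_cost :: "real^'d \<Rightarrow> real" where
  "total_cost x = l (flow x T) + integral {0..T} (\<lambda>t. c t (flow x t))"

lemma flow: "is_state x (flow x)"
  unfolding flow_def by (rule someI_ex[OF state_exists])

lemmas flow_cont = is_state_cont[OF flow]

lemma costate: "is_costate (flow x) (costate x)"
  unfolding costate_def by (rule someI_ex[OF costate_exists[OF flow_cont]])

lemmas costate_cont = is_costate_cont[OF costate]

lemma tangent: "is_tangent (flow x) h (tangent x h)"
  unfolding tangent_def by (rule someI_ex[OF tangent_exists[OF flow_cont]])

lemmas tangent_cont = is_tangent_cont[OF tangent]

lemma second: "is_second (flow x) (costate x) (tangent x h) (second x h)"
  unfolding second_def by (rule someI_ex[OF second_exists[OF flow_cont costate_cont tangent_cont]])

lemma
  shows flow_primitive: "primitive_on T (\<lambda>s. F s (flow x s)) (flow x)" and flow_0: "flow x 0 = x"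
    and costate_primitive: "primitive_on T
      (\<lambda>s. - (transpose (A s (flow x s)) *v costate x s) + g s (flow x s)) (costate x)"
    and costate_T: "costate x T = - gl (flow x T)"
    and tangent_primitive: "primitive_on T (\<lambda>s. A s (flow x s) *v tangent x h s) (tangent x h)"
    and tangent_0: "tangent x h 0 = h"
    and second_primitive: "primitive_on T
      (\<lambda>s. - (transpose (A s (flow x s)) *v second x h s)
           + S s (flow x s) (costate x s) *v tangent x h s) (second x h)"
    and second_T: "second x h T = hl (flow x T) *v tangent x h T"
  using flow costate tangent second
  by (simp_all add: is_state_def is_costate_def is_tangent_def is_second_def)

lemma flow_lip: 
  assumes "t \<in> {0..T}"
  shows "norm (flow y t - flow x t) \<le> exp (K * T) * norm (y - x)"
  using primitive_on_norm_bound[OF primitive_on_diff[OF flow_primitive[of y] flow_primitive[of x]],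
      of K "\<lambda>_. 0" t] F_lip K assms
  by (simp add: integrable_0 flow_0 mult.commute)

lemma tangent_bound:
  assumes "t \<in> {0..T}"
  shows "norm (tangent x h t) \<le> exp (K * T) * norm h"
  using primitive_on_norm_bound[OF tangent_primitive[of x h], of K "\<lambda>_. 0" t] A_mult_bound K assms
  by (simp add: integrable_0 tangent_0 mult.commute)

text \<open>Two of the exponential factors come from the squared Lipschitz bound of the flow inside
  the Taylor remainder, the third from Gronwall, and T from integrating a constant.\<close>

lemma flow_tangent:
  assumes t: "t \<in> {0..T}"
  shows "norm (flow y t - flow x t - tangent x (y - x) t)
    \<le> T * L * (exp (K * T)) ^ 3 * (norm (y - x))\<^sup>2"
proof -
  let ?b = "tangent x (y - x)" and ?r = "L * (exp (K * T) * norm (y - x))\<^sup>2"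
  have "norm (flow y t - flow x t - ?b t) \<le> (norm (flow y 0 - flow x 0 - ?b 0) + integral {0..T} (\<lambda>_. ?r)) * exp (K * T)"
  proof (rule primitive_on_norm_bound[OF
        primitive_on_diff[OF primitive_on_diff[OF flow_primitive flow_primitive] tangent_primitive] _ _ _ K t])
    fix s assume s: "s \<in> {0..T}"
    have "L * (norm (flow y s - flow x s))\<^sup>2 \<le> ?r"
      using L flow_lip[OF s, of y x] by (intro mult_left_mono power_mono) auto
    then have 1: "norm (F s (flow y s) - F s (flow x s) - A s (flow x s) *v (flow y s - flow x s)) \<le> ?r"
      using F_taylor[OF s, of "flow y s" "flow x s"] by linarith
    have 2: "norm (A s (flow x s) *v (flow y s - flow x s - ?b s)) \<le> K * norm (flow y s - flow x s - ?b s)"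
      by (rule A_mult_bound[OF s])
    \<comment> \<open>The first summand is the linear part that Gronwall absorbs, the second is the
      Taylor remainder of \<open>F\<close> along the flow.\<close>
    have "F s (flow y s) - F s (flow x s) - A s (flow x s) *v ?b s
      = A s (flow x s) *v (flow y s - flow x s - ?b s)
        + (F s (flow y s) - F s (flow x s) - A s (flow x s) *v (flow y s - flow x s))"
      by (simp add: matrix_vector_mult_diff_distrib)
    also have "norm \<dots> \<le> K * norm (flow y s - flow x s - ?b s) + ?r"
      using norm_triangle_mono[OF 2 1] .
    finally show "norm (F s (flow y s) - F s (flow x s) - A s (flow x s) *v ?b s)
      \<le> K * norm (flow y s - flow x s - ?b s) + ?r" .
  qed (use L in auto)
  also have "\<dots> = T * L * (exp (K * T)) ^ 3 * (norm (y - x))\<^sup>2"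
    using T by (simp add: flow_0 tangent_0 power2_eq_square power3_eq_cube mult_ac)
  finally show ?thesis .
qed

text \<open>Superposition: sums and multiples of solutions solve the same linear equation, and
  uniqueness identifies them with the chosen solutions.\<close>

lemma linear_tangent: 
  assumes t: "t \<in> {0..T}"
  shows "linear (\<lambda>h. tangent x h t)"
proof (rule linearI)
  fix h k
  have "is_tangent (flow x) (h + k) (\<lambda>s. tangent x h s + tangent x k s)"
    using primitive_on_add[OF tangent_primitive[of x h] tangent_primitive[of x k]]
    by (simp add: is_tangent_def tangent_0 matrix_vector_right_distrib)
  from tangent_unique[OF refl tangent this t]
  show "tangent x (h + k) t = tangent x h t + tangent x k t" .
next
  fix r h
  have "is_tangent (flow x) (r *\<^sub>R h) (\<lambda>s. r *\<^sub>R tangent x h s)"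
    using primitive_on_scaleR[OF tangent_primitive[of x h], of r]
    by (simp add: is_tangent_def tangent_0 matrix_vector_mult_scaleR)
  from tangent_unique[OF refl tangent this t]
  show "tangent x (r *\<^sub>R h) t = r *\<^sub>R tangent x h t" .
qed

lemma linear_second: 
  assumes t: "t \<in> {0..T}"
  shows "linear (\<lambda>h. second x h t)"
proof (rule linearI)
  fix h k
  have "is_second (flow x) (costate x) (\<lambda>s. tangent x h s + tangent x k s) (\<lambda>s. second x h s + second x k s)"
    using primitive_on_add[OF second_primitive[of x h] second_primitive[of x k]]
    by (simp add: is_second_def second_T matrix_vector_right_distrib algebra_simps)
  from second_unique[OF refl refl linear_add[OF linear_tangent] second this t]
  show "second x (h + k) t = second x h t + second x k t" .
next
  fix r h
  have "is_second (flow x) (costate x) (\<lambda>s. r *\<^sub>R tangent x h s) (\<lambda>s. r *\<^sub>R second x h s)"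
    using primitive_on_scaleR[OF second_primitive[of x h], of r]
    by (simp add: is_second_def second_T matrix_vector_mult_scaleR scaleR_diff_right)
  from second_unique[OF refl refl linear_scale[OF linear_tangent] second this t]
  show "second x (r *\<^sub>R h) t = r *\<^sub>R second x h t" .
qed

lemma flow_has_derivative:
  "t \<in> {0..T} \<Longrightarrow> ((\<lambda>y. flow y t) has_derivative (\<lambda>h. tangent x h t)) (at x)"
  by (rule has_derivative_of_quadratic_remainder[OF linear_tangent flow_tangent])

text \<open>The Jacobian terms of the two equations cancel as transposes of each other, and the
  terminal condition of the costate contributes the terminal gradient. The left-hand side is the
  formal derivative of the cost along \<open>h\<close>.\<close>

lemma costate_tangent_identity:
  "gl (flow x T) \<bullet> tangent x h T + integral {0..T} (\<lambda>s. g s (flow x s) \<bullet> tangent x h s)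
    = - costate x 0 \<bullet> h"
proof -
  have "(\<lambda>s. (- (transpose (A s (flow x s)) *v costate x s) + g s (flow x s)) \<bullet> tangent x h s
      + costate x s \<bullet> (A s (flow x s) *v tangent x h s)) = (\<lambda>s. g s (flow x s) \<bullet> tangent x h s)"
    by (simp add: inner_diff_left dot_lmul_matrix)
  then show ?thesis
    using primitive_on_inner[OF costate_primitive[of x] tangent_primitive[of x h]] T
    by (simp add: tangent_0 costate_T)
qed

lemma g_tangent_integrable: "(\<lambda>s. g s (flow x s) \<bullet> tangent x h s) integrable_on {0..T}"
proof -
  have "(\<lambda>s. (\<lambda>a b. b \<bullet> a) (tangent x h s) (g s (flow x s))) absolutely_integrable_on {0..T}"
  proof (rule absolutely_integrable_bounded_measurable_product[where h = "\<lambda>a b. b \<bullet> a"])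
    show "bilinear (\<lambda>a b::real^'d. b \<bullet> a)"
      by (auto simp: bilinear_def linear_iff inner_simps)
    show "tangent x h \<in> borel_measurable time_measure"
      by (rule continuous_imp_measurable_on_sets_lebesgue[OF tangent_cont]) simp
    show "bounded (tangent x h ` {0..T})"
      by (intro compact_imp_bounded compact_continuous_image tangent_cont) simp
  qed (auto intro: g_along_abs flow_cont)
  then show ?thesis by (simp add: absolutely_integrable_on_def)
qed

theorem total_cost_has_derivative: "(total_cost has_derivative (\<lambda>h. - costate x 0 \<bullet> h)) (at x)"
proof (rule has_derivative_of_quadratic_remainder)
  show "linear (\<lambda>h. - costate x 0 \<bullet> h)" by (simp add: linear_iff inner_simps)
  fix y
  let ?n = "norm (y - x)" and ?E = "exp (K * T)" and ?b = "tangent x (y - x)"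
  let ?C = "T * L * ?E ^ 3" and ?g = "\<lambda>s. norm (g s (flow x s))"
  have gi: "?g integrable_on {0..T}"
    using g_along_abs[OF flow_cont, of x] by (simp add: absolutely_integrable_on_def)
  have ci: "(\<lambda>s. c s (flow z s)) integrable_on {0..T}" for z
    using c_along_abs[OF flow_cont, of z] by (simp add: absolutely_integrable_on_def)
  \<comment> \<open>Used for the running cost and for the terminal cost. The error is the Taylor
    remainder of the cost plus the linearisation error of the flow weighted by the norm of the
    gradient \<open>v\<close>; as the weight enters linearly, an integrable gradient
    suffices.\<close>
  have combine: "norm (a - v \<bullet> ?b s) \<le> (L * ?E\<^sup>2 + ?C * norm v) * ?n\<^sup>2"
    if a: "norm (a - v \<bullet> (flow y s - flow x s)) \<le> L * (norm (flow y s - flow x s))\<^sup>2" and s: "s \<in> {0..T}"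
    for a s and v :: "real^'d"
  proof -
    have "L * (norm (flow y s - flow x s))\<^sup>2 \<le> L * (?E * ?n)\<^sup>2"
      using L flow_lip[OF s, of y x] by (intro mult_left_mono power_mono) auto
    moreover have "\<bar>v \<bullet> (flow y s - flow x s - ?b s)\<bar> \<le> norm v * (?C * ?n\<^sup>2)"
      using Cauchy_Schwarz_ineq2 flow_tangent[OF s] by (meson mult_left_mono norm_ge_zero order_trans)
    ultimately show ?thesis
      using a by (simp add: inner_diff_right algebra_simps power_mult_distrib)
  qed
  have "norm (integral {0..T} (\<lambda>s. c s (flow y s) - c s (flow x s) - g s (flow x s) \<bullet> ?b s))
      \<le> integral {0..T} (\<lambda>s. (L * ?E\<^sup>2 + ?C * ?g s) * ?n\<^sup>2)"
  proof (rule Henstock_Kurzweil_Integration.integral_norm_bound_integral)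
    show "(\<lambda>s. (L * ?E\<^sup>2 + ?C * ?g s) * ?n\<^sup>2) integrable_on {0..T}"
      using gi by (intro integrable_on_mult_left integrable_add integrable_on_mult_right) auto
    show "norm (c s (flow y s) - c s (flow x s) - g s (flow x s) \<bullet> ?b s) \<le> (L * ?E\<^sup>2 + ?C * ?g s) * ?n\<^sup>2"
      if "s \<in> {0..T}" for s
      by (rule combine[OF c_taylor[OF that] that])
  qed (intro integrable_diff ci g_tangent_integrable)
  also have "\<dots> = (L * ?E\<^sup>2 * T + ?C * integral {0..T} ?g) * ?n\<^sup>2"
  proof (rule integral_unique)
    have "((\<lambda>_. L * ?E\<^sup>2) has_integral L * ?E\<^sup>2 * T) {0..T}"
      using has_integral_const_real[of "L * ?E\<^sup>2" 0 T] T by (simp add: mult.commute)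
    then show "((\<lambda>s. (L * ?E\<^sup>2 + ?C * ?g s) * ?n\<^sup>2) has_integral
        (L * ?E\<^sup>2 * T + ?C * integral {0..T} ?g) * ?n\<^sup>2) {0..T}"
      by (intro has_integral_mult_left has_integral_add has_integral_mult_right integrable_integral gi)
  qed
  finally have 1: "norm (integral {0..T} (\<lambda>s. c s (flow y s)) - integral {0..T} (\<lambda>s. c s (flow x s))
      - integral {0..T} (\<lambda>s. g s (flow x s) \<bullet> ?b s)) \<le> (L * ?E\<^sup>2 * T + ?C * integral {0..T} ?g) * ?n\<^sup>2"
    using ci g_tangent_integrable by (simp add: Henstock_Kurzweil_Integration.integral_diff integrable_diff)
  have 2: "norm (l (flow y T) - l (flow x T) - gl (flow x T) \<bullet> ?b T) \<le> (L * ?E\<^sup>2 + ?C * norm (gl (flow x T))) * ?n\<^sup>2"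
    by (rule combine[OF l_taylor]) (use T in simp)
  have "total_cost y - total_cost x - - costate x 0 \<bullet> (y - x)
      = (l (flow y T) - l (flow x T) - gl (flow x T) \<bullet> ?b T)
        + (integral {0..T} (\<lambda>s. c s (flow y s)) - integral {0..T} (\<lambda>s. c s (flow x s))
           - integral {0..T} (\<lambda>s. g s (flow x s) \<bullet> ?b s))"
    unfolding total_cost_def costate_tangent_identity[symmetric] by simp
  then show "norm (total_cost y - total_cost x - - costate x 0 \<bullet> (y - x))
      \<le> (L * ?E\<^sup>2 + ?C * norm (gl (flow x T)) + (L * ?E\<^sup>2 * T + ?C * integral {0..T} ?g)) * ?n\<^sup>2"
    using norm_triangle_mono[OF 2 1] by (simp only: distrib_right)
qed

section \<open>Second derivative in the initial value\<close>

text \<open>The costate stays that of the base point \<open>x\<close> while the state varies, which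
  separates the two ways in which the costate equation depends on the initial value.\<close>

definition costate_field :: "real^'d \<Rightarrow> real \<Rightarrow> real^'d \<Rightarrow> real^'d" where
  "costate_field x s \<xi> = g s \<xi> - transpose (A s \<xi>) *v costate x s"

text \<open>The constant may depend on the base point \<open>x\<close>, through the size of its
  costate, but not on \<open>y\<close>. The backward bound is fed by the Lipschitz terminal gradient
  and by the change of state inside the costate field.\<close>

lemma costate_lip:
  "\<exists>C\<ge>0. \<forall>y. \<forall>t\<in>{0..T}. norm (costate y t - costate x t) \<le> C * norm (y - x)"
proof -
  let ?E = "exp (K * T)"
  have ci: "(\<lambda>s. L * (1 + norm (costate x s)) * ?E) absolutely_integrable_on {0..T}" (is "?r absolutely_integrable_on _")
    by (intro absolutely_integrable_continuous_real continuous_intros costate_cont)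
  have r0: "?r s \<ge> 0" for s using L by simp
  have I0: "integral {0..T} ?r \<ge> 0"
    using ci r0 by (intro integral_nonneg) (auto simp: absolutely_integrable_on_def)
  have "norm (costate y t - costate x t) \<le> (L * ?E + integral {0..T} ?r) * ?E * norm (y - x)"
    if t: "t \<in> {0..T}" for y t
  proof -
    have "norm (costate y t - costate x t)
        \<le> (norm (costate y T - costate x T) + integral {0..T} (\<lambda>s. ?r s * norm (y - x))) * ?E"
    proof (rule primitive_on_norm_bound_backward[OF primitive_on_diff[OF costate_primitive costate_primitive] _ _ _ K t])
      fix s assume s: "s \<in> {0..T}"
      have 1: "norm (- (transpose (A s (flow y s)) *v (costate y s - costate x s))) \<le> K * norm (costate y s - costate x s)"
        using transpose_A_mult_bound[OF s] by simp
      have "norm (costate_field x s (flow y s) - costate_field x s (flow x s))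
          \<le> L * (1 + norm (costate x s)) * norm (flow y s - flow x s)"
        unfolding costate_field_def by (rule costate_field_lip[OF s])
      also have "\<dots> \<le> L * (1 + norm (costate x s)) * (?E * norm (y - x))"
        using L flow_lip[OF s] by (intro mult_left_mono) auto
      finally have 2: "norm (costate_field x s (flow y s) - costate_field x s (flow x s)) \<le> ?r s * norm (y - x)"
        by (simp add: mult_ac)
      have "- (transpose (A s (flow y s)) *v costate y s) + g s (flow y s)
          - (- (transpose (A s (flow x s)) *v costate x s) + g s (flow x s))
          = - (transpose (A s (flow y s)) *v (costate y s - costate x s))
            + (costate_field x s (flow y s) - costate_field x s (flow x s))"
        by (simp add: costate_field_def matrix_vector_mult_diff_distrib)
      then show "norm (- (transpose (A s (flow y s)) *v costate y s) + g s (flow y s)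
          - (- (transpose (A s (flow x s)) *v costate x s) + g s (flow x s)))
          \<le> K * norm (costate y s - costate x s) + ?r s * norm (y - x)"
        using norm_triangle_mono[OF 1 2] by (simp only:)
    next
      show "(\<lambda>s. ?r s * norm (y - x)) absolutely_integrable_on {0..T}"
        by (intro absolutely_integrable_continuous_real continuous_intros costate_cont)
    qed (use L in auto)
    also have "integral {0..T} (\<lambda>s. ?r s * norm (y - x)) = integral {0..T} ?r * norm (y - x)"
      by (rule Henstock_Kurzweil_Integration.integral_mult_left)
    also have "norm (costate y T - costate x T) \<le> L * ?E * norm (y - x)"
    proof -
      have "norm (costate y T - costate x T) \<le> L * norm (flow y T - flow x T)"
        using gl_lip[of "flow x T" "flow y T"] by (simp add: costate_T norm_minus_commute)
      also have "\<dots> \<le> L * (?E * norm (y - x))"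
        using L T by (intro mult_left_mono flow_lip) auto
      finally show ?thesis by (simp add: mult.assoc)
    qed
    finally show ?thesis by (simp add: algebra_simps)
  qed
  moreover have "(L * ?E + integral {0..T} ?r) * ?E \<ge> 0" using L I0 by simp
  ultimately show ?thesis by blast
qed

text \<open>The error \<open>w\<close> solves the linear costate equation with forcing
  \<open>R\<close>, so it suffices that its terminal value and the integral of the norm of
  \<open>R\<close> are o(norm (y - x)).\<close>

theorem costate_has_derivative: "((\<lambda>y. costate y 0) has_derivative (\<lambda>h. - second x h 0)) (at x)"
proof -
  let ?E = "exp (K * T)"
  obtain C where C: "C \<ge> 0" "\<And>y t. t \<in> {0..T} \<Longrightarrow> norm (costate y t - costate x t) \<le> C * norm (y - x)"
    using costate_lip[of x] by blast
  \<comment> \<open>\<open>Q\<close> is the linearisation error of the costate field along the flow;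
    \<open>R\<close> adds the product of two first-order increments, of the Jacobian and of the
    costate.\<close>
  define Q where "Q y s = costate_field x s (flow y s) - costate_field x s (flow x s)
      + S s (flow x s) (costate x s) *v tangent x (y - x) s" for y s
  define R where "R y s = - (transpose (A s (flow y s) - A s (flow x s)) *v (costate y s - costate x s)) + Q y s" for y s
  define w where "w y s = costate y s - costate x s + second x (y - x) s" for y s
  have w_prim: "primitive_on T (\<lambda>s. - (transpose (A s (flow x s)) *v w y s) + R y s) (w y)" for y
  proof -
    have eq: "- (transpose (A s (flow y s)) *v costate y s) + g s (flow y s)
        - (- (transpose (A s (flow x s)) *v costate x s) + g s (flow x s))
        + (- (transpose (A s (flow x s)) *v second x (y - x) s)
           + S s (flow x s) (costate x s) *v tangent x (y - x) s)
        = - (transpose (A s (flow x s)) *v w y s) + R y s" for s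
      by (simp add: w_def R_def Q_def costate_field_def algebra_simps)
    show ?thesis
      using primitive_on_add[OF primitive_on_diff[OF costate_primitive[of y] costate_primitive[of x]]
          second_primitive[of x "y - x"]]
      unfolding eq w_def[symmetric, abs_def] .
  qed
  \<comment> \<open>Integrability of \<open>R\<close> is read off from the equation of
    \<open>w\<close> by removing the linear term, instead of term by term.\<close>
  have R_abs: "R y absolutely_integrable_on {0..T}" for y
  proof -
    have "integrable_lipschitz_field T K (\<lambda>s z. - transpose (A s (flow x s)) *v z + 0)"
      by (rule linear_field_integrable_lipschitz[OF transpose_A_along_meas[OF flow_cont] _ K])
        (use A_bound in \<open>auto simp: norm_transpose\<close>)
    then have "(\<lambda>s. - transpose (A s (flow x s)) *v w y s + 0) absolutely_integrable_on {0..T}"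
      using primitive_on_continuous[OF w_prim] unfolding integrable_lipschitz_field_def by blast
    then have "(\<lambda>s. - (transpose (A s (flow x s)) *v w y s)) absolutely_integrable_on {0..T}"
      by (simp add: uminus_matrix_vector_mult)
    from set_integral_diff(1)[OF primitive_on_abs[OF w_prim[of y]] this] show ?thesis by simp
  qed
  have w0: "norm (w y 0) \<le> (norm (w y T) + integral {0..T} (\<lambda>s. norm (R y s))) * ?E" for y
  proof (rule primitive_on_norm_bound_backward[OF w_prim _ _ _ K])
    fix s assume s: "s \<in> {0..T}"
    show "norm (- (transpose (A s (flow x s)) *v w y s) + R y s) \<le> K * norm (w y s) + norm (R y s)"
      using norm_triangle_mono[of "- (transpose (A s (flow x s)) *v w y s)" "K * norm (w y s)" "R y s"]
        transpose_A_mult_bound[OF s] by simp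
  qed (use T absolutely_integrable_norm[OF R_abs[of y]] in \<open>auto simp: o_def\<close>)
  have "((\<lambda>y. gl (flow y T)) has_derivative (\<lambda>h. hl (flow x T) *v tangent x h T)) (at x)"
    using T by (intro has_derivative_compose[OF flow_has_derivative gl_deriv]) simp
  \<comment> \<open>At the terminal time the error is that of linearising the terminal gradient
    composed with the flow, where the chain rule applies.\<close>
  moreover have "w y T = - (gl (flow y T) - gl (flow x T) - hl (flow x T) *v tangent x (y - x) T)" for y
    by (simp add: w_def costate_T second_T)
  ultimately have lim_T: "((\<lambda>y. norm (w y T) / norm (y - x)) \<longlongrightarrow> 0) (at x)"
    by (simp add: has_derivative_iff_norm norm_minus_commute)
  have lim_R: "((\<lambda>y. norm (R y s) / norm (y - x)) \<longlongrightarrow> 0) (at x)" if s: "s \<in> {0..T}" for s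
  proof -
    have "((\<lambda>y. costate_field x s (flow y s)) has_derivative
        (\<lambda>h. - (S s (flow x s) (costate x s) *v tangent x h s))) (at x)"
      unfolding costate_field_def
      by (rule has_derivative_compose[OF flow_has_derivative[OF s] S_deriv[OF s]])
    then have "((\<lambda>y. norm (Q y s) / norm (y - x)) \<longlongrightarrow> 0) (at x)"
      by (simp add: has_derivative_iff_norm Q_def)
    moreover have "((\<lambda>y. L * ?E * C * norm (y - x)) \<longlongrightarrow> L * ?E * C * norm (x - x)) (at x)"
      by (intro tendsto_intros)
    ultimately have lim: "((\<lambda>y. L * ?E * C * norm (y - x) + norm (Q y s) / norm (y - x)) \<longlongrightarrow> 0) (at x)"
      using tendsto_add by fastforce
    have le: "norm (R y s) / norm (y - x) \<le> L * ?E * C * norm (y - x) + norm (Q y s) / norm (y - x)"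
      if "y \<noteq> x" for y
    proof -
      have "norm (transpose (A s (flow y s) - A s (flow x s)) *v (costate y s - costate x s))
          \<le> norm (A s (flow y s) - A s (flow x s)) * norm (costate y s - costate x s)"
        using norm_matrix_vector_mult_le[of "transpose (A s (flow y s) - A s (flow x s))"]
        by (simp add: norm_transpose)
      also have "\<dots> \<le> (L * (?E * norm (y - x))) * (C * norm (y - x))"
        using L C s
        by (intro mult_mono order_trans[OF A_lip[OF s] mult_left_mono[OF flow_lip[OF s]]]) auto
      finally have "norm (R y s) \<le> L * ?E * C * norm (y - x) * norm (y - x) + norm (Q y s)"
        unfolding R_def
        using norm_triangle_ineq[of "- (transpose (A s (flow y s) - A s (flow x s)) *v (costate y s - costate x s))" "Q y s"]
        by (simp add: mult_ac)
      then show ?thesis using that by (simp add: field_simps)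
    qed
    show ?thesis
      by (rule tendsto_sandwich[OF _ _ tendsto_const lim])
        (use le in \<open>auto simp: eventually_at_filter\<close>)
  qed
  \<comment> \<open>The Jacobian increment is bounded by 2K instead of its Lipschitz estimate, so
    that the quotient gets a continuous majorant independent of \<open>y\<close>. At y = x the
    quotient is 0 by the convention for division by 0.\<close>
  have R_bound: "norm (R y s) / norm (y - x) \<le> 2 * K * C + 2 * (L * (1 + norm (costate x s)) * ?E)"
    if s: "s \<in> {0..T}" for y s
  proof (cases "y = x")
    case True
    then show ?thesis using K C L by simp
  next
    case False
    have "norm (transpose (A s (flow y s) - A s (flow x s)) *v (costate y s - costate x s))
        \<le> norm (A s (flow y s) - A s (flow x s)) * norm (costate y s - costate x s)"
      using norm_matrix_vector_mult_le[of "transpose (A s (flow y s) - A s (flow x s))"]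
      by (simp add: norm_transpose)
    also have "\<dots> \<le> (K + K) * (C * norm (y - x))"
      using K C s by (intro mult_mono order_trans[OF norm_triangle_ineq4 add_mono] A_bound) auto
    finally have 1: "norm (- (transpose (A s (flow y s) - A s (flow x s)) *v (costate y s - costate x s)))
        \<le> 2 * K * C * norm (y - x)" by simp
    have "norm (costate_field x s (flow y s) - costate_field x s (flow x s))
        \<le> L * (1 + norm (costate x s)) * norm (flow y s - flow x s)"
      unfolding costate_field_def by (rule costate_field_lip[OF s])
    also have "\<dots> \<le> L * (1 + norm (costate x s)) * (?E * norm (y - x))"
      using L flow_lip[OF s] by (intro mult_left_mono) auto
    finally have 2: "norm (costate_field x s (flow y s) - costate_field x s (flow x s))
        \<le> L * (1 + norm (costate x s)) * (?E * norm (y - x))" .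
    have "norm (S s (flow x s) (costate x s) *v tangent x (y - x) s)
        \<le> L * (1 + norm (costate x s)) * norm (tangent x (y - x) s)"
      by (rule S_bound[OF s])
    also have "\<dots> \<le> L * (1 + norm (costate x s)) * (?E * norm (y - x))"
      using L tangent_bound[OF s] by (intro mult_left_mono) auto
    finally have 3: "norm (S s (flow x s) (costate x s) *v tangent x (y - x) s)
        \<le> L * (1 + norm (costate x s)) * (?E * norm (y - x))" .
    have "norm (R y s) \<le> (2 * K * C + 2 * (L * (1 + norm (costate x s)) * ?E)) * norm (y - x)"
      unfolding R_def Q_def using norm_triangle_mono[OF 1 norm_triangle_mono[OF 2 3]]
      by (simp add: algebra_simps)
    then show ?thesis using False by (simp add: pos_divide_le_eq)
  qed
  have lim_int: "((\<lambda>y. integral {0..T} (\<lambda>s. norm (R y s) / norm (y - x))) \<longlongrightarrow> 0) (at x)"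
    \<comment> \<open>Dominated convergence is a statement about sequences, so the limit is tested
      along arbitrary sequences tending to \<open>x\<close>.\<close>
    unfolding tendsto_at_iff_sequentially
  proof (intro allI impI)
    fix z :: "nat \<Rightarrow> real^'d" assume z: "\<forall>i. z i \<in> UNIV - {x}" "z \<longlonglongrightarrow> x"
    have "(\<lambda>k. integral {0..T} (\<lambda>s. norm (R (z k) s) / norm (z k - x))) \<longlonglongrightarrow> integral {0..T} (\<lambda>_. 0)"
    proof (rule dominated_convergence(2)[where h = "\<lambda>s. 2 * K * C + 2 * (L * (1 + norm (costate x s)) * ?E)"])
      show "(\<lambda>s. norm (R (z k) s) / norm (z k - x)) integrable_on {0..T}" for k
        using R_abs[of "z k"]
        by (auto simp: absolutely_integrable_on_def divide_inverse intro: integrable_on_mult_left)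
      show "(\<lambda>s. 2 * K * C + 2 * (L * (1 + norm (costate x s)) * ?E)) integrable_on {0..T}"
        by (intro integrable_continuous_real continuous_intros costate_cont)
      show "norm (norm (R (z k) s) / norm (z k - x)) \<le> 2 * K * C + 2 * (L * (1 + norm (costate x s)) * ?E)"
        if "s \<in> {0..T}" for k s
        using R_bound[OF that, of "z k"] by simp
      show "(\<lambda>k. norm (R (z k) s) / norm (z k - x)) \<longlonglongrightarrow> 0" if "s \<in> {0..T}" for s
        using lim_R[OF that] z unfolding tendsto_at_iff_sequentially o_def by blast
    qed
    then show "((\<lambda>y. integral {0..T} (\<lambda>s. norm (R y s) / norm (y - x))) \<circ> z) \<longlonglongrightarrow> 0"
      by (simp add: o_def)
  qed
  have lim: "((\<lambda>y. (norm (w y T) / norm (y - x) + integral {0..T} (\<lambda>s. norm (R y s) / norm (y - x))) * ?E)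
      \<longlongrightarrow> (0 + 0) * ?E) (at x)"
    by (intro tendsto_intros lim_T lim_int)
  have "norm (w y 0) / norm (y - x)
      \<le> (norm (w y T) / norm (y - x) + integral {0..T} (\<lambda>s. norm (R y s) / norm (y - x))) * ?E" for y
    using divide_right_mono[OF w0[of y], of "norm (y - x)"] by (simp add: add_divide_distrib distrib_right)
  then have "((\<lambda>y. norm (w y 0) / norm (y - x)) \<longlongrightarrow> 0) (at x)"
    by (intro tendsto_sandwich[OF _ _ tendsto_const lim[simplified]]) auto
  moreover have "bounded_linear (\<lambda>h. - second x h 0)"
    using linear_second[of 0 x] T by (simp add: linear_conv_bounded_linear bounded_linear_minus)
  ultimately show ?thesis
    by (simp add: has_derivative_iff_norm w_def)
qed

end

section \<open>The adjoint system of an admissible control\<close>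

text \<open>\<open>S\<close> may fail to be Borel, so the composition passes through the Borel
  structure restricted to \<open>S\<close>, where continuity on \<open>S\<close> gives
  measurability.\<close>

lemma borel_measurable_compose_continuous_on:
  assumes g: "continuous_on S g" and \<theta>: "\<theta> \<in> borel_measurable M" "\<And>t. t \<in> space M \<Longrightarrow> \<theta> t \<in> S"
  shows "(\<lambda>t. g (\<theta> t)) \<in> borel_measurable M"
proof -
  have "\<theta> \<in> measurable M (restrict_space borel S)"
    using \<theta> by (intro measurable_restrict_space2) auto
  from measurable_compose[OF this borel_measurable_continuous_on_restrict[OF g]] show ?thesis .
qed

lemma C2_differentiable:
  assumes "C2 g"
  shows "g differentiable (at x)" "grad g differentiable (at x)"
  using assms by (auto simp: C2_def twice_differentiable_def)

lemma controlled_flow_of_control: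
  fixes f :: "real^'d \<Rightarrow> 'c::real_normed_vector \<Rightarrow> real^'d"
  assumes T: "T > 0"
    and \<theta>: "admissible_control T \<Theta>\<^sub>0 \<Phi> \<theta>"
    and f_bounded: "\<exists>M. \<forall>\<xi>. \<forall>v\<in>\<Theta>\<^sub>0. norm (f \<xi> v) \<le> M"
    and f_cont: "\<And>\<xi>. continuous_on \<Theta>\<^sub>0 (f \<xi>)"
    and f_C2: "\<And>v k. v \<in> \<Theta>\<^sub>0 \<Longrightarrow> C2 (\<lambda>\<xi>. f \<xi> v $ k)"
    and \<Phi>_C2: "\<And>v. v \<in> \<Theta>\<^sub>0 \<Longrightarrow> C2 (\<lambda>\<xi>. \<Phi> \<xi> v)"
    and l_C2: "\<And>v. v \<in> \<Theta>\<^sub>0 \<Longrightarrow> C2 (\<lambda>\<xi>. l \<xi> v)"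
    and f_Lip: "\<exists>L. \<forall>v\<in>\<Theta>\<^sub>0. L-lipschitz_on UNIV (\<lambda>\<xi>. jacobian (\<lambda>\<zeta>. f \<zeta> v) (at \<xi>))"
    and \<Phi>_Lip: "\<exists>L. \<forall>v\<in>\<Theta>\<^sub>0. L-lipschitz_on UNIV (grad (\<lambda>\<zeta>. \<Phi> \<zeta> v))"
    and l_Lip: "\<exists>L. \<forall>v\<in>\<Theta>\<^sub>0. L-lipschitz_on UNIV (grad (\<lambda>\<zeta>. l \<zeta> v))"
  shows "\<exists>M K L. controlled_flow T M K L (\<lambda>t \<xi>. f \<xi> (\<theta> t)) (\<lambda>t \<xi>. jacobian (\<lambda>\<zeta>. f \<zeta> (\<theta> t)) (at \<xi>))
    (\<lambda>t \<xi>. \<Phi> \<xi> (\<theta> t)) (\<lambda>t \<xi>. grad (\<lambda>\<zeta>. \<Phi> \<zeta> (\<theta> t)) \<xi>)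
    (\<lambda>t \<xi> \<pi>. D2_transpose (\<lambda>\<zeta>. f \<zeta> (\<theta> t)) \<xi> \<pi> - hess (\<lambda>\<zeta>. \<Phi> \<zeta> (\<theta> t)) \<xi>)
    (\<lambda>\<xi>. l \<xi> (\<theta> T)) (grad (\<lambda>\<zeta>. l \<zeta> (\<theta> T))) (hess (\<lambda>\<zeta>. l \<zeta> (\<theta> T)))"
proof -
  have \<theta>_in: "\<theta> t \<in> \<Theta>\<^sub>0" if "t \<in> {0..T}" for t
    using \<theta> that by (simp add: admissible_control_def)
  have \<theta>_meas: "\<theta> \<in> borel_measurable (lebesgue_on {0..T})"
    using \<theta> by (simp add: admissible_control_def)
  have \<Phi>_abs: "(\<lambda>t. \<Phi> \<xi> (\<theta> t)) absolutely_integrable_on {0..T}" for \<xi>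
    using \<theta> by (simp add: admissible_control_def)
  have T0: "0 \<in> {0..T}" "T \<in> {0..T}" using T by auto
  obtain M where M: "\<And>\<xi> v. v \<in> \<Theta>\<^sub>0 \<Longrightarrow> norm (f \<xi> v) \<le> M" using f_bounded by blast
  obtain L1 L2 L3 where lips: "\<And>v. v \<in> \<Theta>\<^sub>0 \<Longrightarrow> L1-lipschitz_on UNIV (\<lambda>\<xi>. jacobian (\<lambda>\<zeta>. f \<zeta> v) (at \<xi>))"
    "\<And>v. v \<in> \<Theta>\<^sub>0 \<Longrightarrow> L2-lipschitz_on UNIV (grad (\<lambda>\<zeta>. \<Phi> \<zeta> v))"
    "\<And>v. v \<in> \<Theta>\<^sub>0 \<Longrightarrow> L3-lipschitz_on UNIV (grad (\<lambda>\<zeta>. l \<zeta> v))"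
    using f_Lip \<Phi>_Lip l_Lip by blast
  define L where "L = max L1 (max L2 L3)"
  \<comment> \<open>The value \<open>\<theta> 0\<close> shows that the parameter set is nonempty;
    over an empty set the constants could be negative.\<close>
  have L: "0 \<le> L" using lipschitz_on_nonneg[OF lips(1)[OF \<theta>_in[OF T0(1)]]] by (simp add: L_def)
  have L_lips: "norm (jacobian (\<lambda>\<zeta>. f \<zeta> v) (at \<xi>) - jacobian (\<lambda>\<zeta>. f \<zeta> v) (at \<eta>)) \<le> L * norm (\<xi> - \<eta>)"
    "norm (grad (\<lambda>\<zeta>. \<Phi> \<zeta> v) \<xi> - grad (\<lambda>\<zeta>. \<Phi> \<zeta> v) \<eta>) \<le> L * norm (\<xi> - \<eta>)"
    "norm (grad (\<lambda>\<zeta>. l \<zeta> v) \<xi> - grad (\<lambda>\<zeta>. l \<zeta> v) \<eta>) \<le> L * norm (\<xi> - \<eta>)" if "v \<in> \<Theta>\<^sub>0" for v \<xi> \<eta>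
    using lipschitz_onD[OF lipschitz_on_le[OF lips(1)[OF that], of L], of \<xi> \<eta>]
      lipschitz_onD[OF lipschitz_on_le[OF lips(2)[OF that], of L], of \<xi> \<eta>]
      lipschitz_onD[OF lipschitz_on_le[OF lips(3)[OF that], of L], of \<xi> \<eta>]
    by (auto simp: dist_norm L_def)
  have f_deriv: "((\<lambda>\<zeta>. f \<zeta> v) has_derivative (\<lambda>h. jacobian (\<lambda>\<zeta>. f \<zeta> v) (at \<xi>) *v h)) (at \<xi>)"
    if "v \<in> \<Theta>\<^sub>0" for v \<xi>
    using differentiable_vec_componentwise[of "\<lambda>\<zeta>. f \<zeta> v", OF C2_differentiable(1)[OF f_C2[OF that]]]
    by (simp add: jacobian_works)
  \<comment> \<open>2M + L bounds the operator norm of a derivative with Lipschitz constant L of a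
    function bounded by M; the dimension factors pass to the Frobenius norm.\<close>
  define K where "K = real CARD('d) * real CARD('d) * (2 * M + L)"
  have "0 \<le> M" using M[OF \<theta>_in[OF T0(1)]] norm_ge_zero order_trans by blast
  then have K: "0 \<le> K" using L by (simp add: K_def)
  have K_bound: "norm (jacobian (\<lambda>\<zeta>. f \<zeta> v) (at \<xi>)) \<le> K" if v: "v \<in> \<Theta>\<^sub>0" for v \<xi>
    unfolding K_def
  proof (rule norm_matrix_le_of_columns)
    fix h
    show "norm (jacobian (\<lambda>\<zeta>. f \<zeta> v) (at \<xi>) *v h) \<le> (2 * M + L) * norm h"
    proof (rule bounded_lipschitz_derivative_bound[OF f_deriv[OF v] _ L M[OF v]])
      fix y z and k :: "real^'d"
      have "norm (jacobian (\<lambda>\<zeta>. f \<zeta> v) (at y) - jacobian (\<lambda>\<zeta>. f \<zeta> v) (at z)) * norm k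
          \<le> L * norm (y - z) * norm k"
        by (intro mult_right_mono L_lips v) auto
      then show "norm (jacobian (\<lambda>\<zeta>. f \<zeta> v) (at y) *v k - jacobian (\<lambda>\<zeta>. f \<zeta> v) (at z) *v k)
          \<le> L * norm (y - z) * norm k"
        using norm_matrix_vector_mult_le[of "jacobian (\<lambda>\<zeta>. f \<zeta> v) (at y) - jacobian (\<lambda>\<zeta>. f \<zeta> v) (at z)" k]
        by (simp add: matrix_vector_mult_diff_rdistrib)
    qed
  qed
  show ?thesis
  proof (intro exI)
    show "controlled_flow T M K L (\<lambda>t \<xi>. f \<xi> (\<theta> t)) (\<lambda>t \<xi>. jacobian (\<lambda>\<zeta>. f \<zeta> (\<theta> t)) (at \<xi>))
      (\<lambda>t \<xi>. \<Phi> \<xi> (\<theta> t)) (\<lambda>t \<xi>. grad (\<lambda>\<zeta>. \<Phi> \<zeta> (\<theta> t)) \<xi>)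
      (\<lambda>t \<xi> \<pi>. D2_transpose (\<lambda>\<zeta>. f \<zeta> (\<theta> t)) \<xi> \<pi> - hess (\<lambda>\<zeta>. \<Phi> \<zeta> (\<theta> t)) \<xi>)
      (\<lambda>\<xi>. l \<xi> (\<theta> T)) (grad (\<lambda>\<zeta>. l \<zeta> (\<theta> T))) (hess (\<lambda>\<zeta>. l \<zeta> (\<theta> T)))"
    proof unfold_locales
      show "(\<lambda>t. f \<xi> (\<theta> t)) \<in> borel_measurable (lebesgue_on {0..T})" for \<xi>
        by (rule borel_measurable_compose_continuous_on[OF f_cont \<theta>_meas]) (use \<theta>_in in simp)
      fix t assume t: "t \<in> {0..T}"
      note v = \<theta>_in[OF t]
      show "norm (f \<xi> (\<theta> t)) \<le> M" for \<xi> by (rule M[OF v])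
      show "((\<lambda>\<zeta>. f \<zeta> (\<theta> t)) has_derivative (\<lambda>h. jacobian (\<lambda>\<zeta>. f \<zeta> (\<theta> t)) (at \<xi>) *v h)) (at \<xi>)" for \<xi>
        by (rule f_deriv[OF v])
      show "((\<lambda>\<zeta>. \<Phi> \<zeta> (\<theta> t)) has_derivative (\<lambda>h. grad (\<lambda>\<zeta>. \<Phi> \<zeta> (\<theta> t)) \<xi> \<bullet> h)) (at \<xi>)" for \<xi>
        by (rule has_derivative_grad[OF C2_differentiable(1)[OF \<Phi>_C2[OF v]]])
      show "((\<lambda>\<xi>. grad (\<lambda>\<zeta>. \<Phi> \<zeta> (\<theta> t)) \<xi> - transpose (jacobian (\<lambda>\<zeta>. f \<zeta> (\<theta> t)) (at \<xi>)) *v \<pi>) has_derivative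
          (\<lambda>h. - ((D2_transpose (\<lambda>\<zeta>. f \<zeta> (\<theta> t)) \<xi> \<pi> - hess (\<lambda>\<zeta>. \<Phi> \<zeta> (\<theta> t)) \<xi>) *v h))) (at \<xi>)" for \<xi> \<pi>
        unfolding matrix_vector_mult_diff_rdistrib minus_diff_eq
        by (intro has_derivative_diff has_derivative_hess has_derivative_jacobian_transpose
            C2_differentiable(2)[OF \<Phi>_C2[OF v]]) (use f_C2[OF v] in \<open>simp add: C2_def\<close>)
      have cont: "continuous_on UNIV (\<lambda>z :: (real^'d) \<times> (real^'d). hess G (fst z))" if "C2 G" for G :: "real^'d \<Rightarrow> real"
        by (rule continuous_on_compose2[of UNIV "hess G"])
          (use that in \<open>auto simp: C2_def intro!: continuous_intros\<close>)
      show "continuous_on UNIV (\<lambda>z. D2_transpose (\<lambda>\<zeta>. f \<zeta> (\<theta> t)) (fst z) (snd z) - hess (\<lambda>\<zeta>. \<Phi> \<zeta> (\<theta> t)) (fst z))"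
        unfolding D2_transpose_def
        by (intro continuous_intros cont \<Phi>_C2[OF v] f_C2[OF v])
    next
      show "((\<lambda>\<zeta>. l \<zeta> (\<theta> T)) has_derivative (\<lambda>h. grad (\<lambda>\<zeta>. l \<zeta> (\<theta> T)) \<xi> \<bullet> h)) (at \<xi>)" for \<xi>
        by (rule has_derivative_grad[OF C2_differentiable(1)[OF l_C2[OF \<theta>_in[OF T0(2)]]]])
      show "(grad (\<lambda>\<zeta>. l \<zeta> (\<theta> T)) has_derivative (\<lambda>h. hess (\<lambda>\<zeta>. l \<zeta> (\<theta> T)) \<xi> *v h)) (at \<xi>)" for \<xi>
        by (rule has_derivative_hess[OF C2_differentiable(2)[OF l_C2[OF \<theta>_in[OF T0(2)]]]])
    qed (use T K L L_lips K_bound \<theta>_in T0 \<Phi>_abs in auto)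
  qed
qed

section \<open>Exponents and the equality of the two objectives\<close>

text \<open>For finite p, q = p/(p - 1), so q - 2 = -(p - 2)/(p - 1) = -(1 - 1/(p - 1)); for
  infinite p, q = 1 and both sides of the second identity are 2.\<close>

lemma conjugate_exponent_identities:
  assumes p: "2 \<le> p" and q: "1 / p + 1 / ereal q = 1"
  shows "real_of_ereal (2 / p) = 2 * real_of_ereal (1 / p)"
    and "2 * (1 - real_of_ereal (1 / (p - 1))) = - (2 * (q - 2))"
proof -
  have "real_of_ereal (2 / p) = 2 * real_of_ereal (1 / p) \<and>
      2 * (1 - real_of_ereal (1 / (p - 1))) = - (2 * (q - 2))"
  proof (cases p)
  case (real r)
  have r: "r \<ge> 2" using p real by simp
  \<comment> \<open>The extended reciprocal of 0 is infinite, which would break the conjugacy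
    relation.\<close>
  have q0: "q \<noteq> 0" using q real r by (auto simp: one_ereal_def divide_ereal_def)
  have "1 / r + 1 / q = 1" using q real r q0 by (simp add: one_ereal_def)
  then have "q = r / (r - 1)" using r q0 by (simp add: field_simps)
  then show ?thesis
    using real r by (simp add: one_ereal_def numeral_eq_ereal field_simps)
next
  case PInf
  have q0: "q \<noteq> 0" using q PInf by (auto simp: one_ereal_def divide_ereal_def)
  then have "q = 1" using q PInf by (simp add: one_ereal_def)
  then show ?thesis using PInf by simp
  qed (use p in simp)
  then show "real_of_ereal (2 / p) = 2 * real_of_ereal (1 / p)"
    and "2 * (1 - real_of_ereal (1 / (p - 1))) = - (2 * (q - 2))" by auto
qed

text \<open>Applied at the norm of the gradient. Where it vanishes, both sides are 0 for nonzero
  \<open>b\<close>, by division by 0, and 1 for b = 0, that is, for q = 2.\<close>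

lemma rpow_square: "rpow a b * rpow a b = 1 / rpow a (- (2 * b))"
  using powr_add[of a b b] by (simp add: rpow_def powr_minus divide_inverse)

text \<open>Of the two factors on the right, with b = 1/p, one comes from the initial value of
  \<beta> and the other from the denominator in the adjoint objective.\<close>

lemma rpow_neg_double: "rpow a (- (2 * b)) = rpow a (- b) / rpow a b"
  using powr_add[of a b b] by (simp add: rpow_def powr_minus divide_inverse)

text \<open>The Hessians in the equation for \<open>\<alpha>\<close> occur transposed, while differentiating the costate equation
  yields them untransposed; continuity of the second derivatives makes the two agree.\<close>

lemma adjoint_reformulation:
  fixes f :: "real^'d \<Rightarrow> 'c::real_normed_vector \<Rightarrow> real^'d"
  assumes T: "T > 0"
    and p: "2 \<le> p"
    and q: "1 / p + 1 / ereal q = 1"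
    and \<theta>: "admissible_control T \<Theta>\<^sub>0 \<Phi> \<theta>"
    and f_bounded: "\<exists>M. \<forall>\<xi>. \<forall>v\<in>\<Theta>\<^sub>0. norm (f \<xi> v) \<le> M"
    and f_cont: "\<And>\<xi>. continuous_on \<Theta>\<^sub>0 (f \<xi>)"
    and f_C2: "\<And>v k. v \<in> \<Theta>\<^sub>0 \<Longrightarrow> C2 (\<lambda>\<xi>. f \<xi> v $ k)"
    and \<Phi>_C2: "\<And>v. v \<in> \<Theta>\<^sub>0 \<Longrightarrow> C2 (\<lambda>\<xi>. \<Phi> \<xi> v)"
    and l_C2: "\<And>v. v \<in> \<Theta>\<^sub>0 \<Longrightarrow> C2 (\<lambda>\<xi>. l \<xi> v)"
    and f_Lip: "\<exists>L. \<forall>v\<in>\<Theta>\<^sub>0. L-lipschitz_on UNIV (\<lambda>\<xi>. jacobian (\<lambda>\<zeta>. f \<zeta> v) (at \<xi>))"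
    and \<Phi>_Lip: "\<exists>L. \<forall>v\<in>\<Theta>\<^sub>0. L-lipschitz_on UNIV (grad (\<lambda>\<zeta>. \<Phi> \<zeta> v))"
    and l_Lip: "\<exists>L. \<forall>v\<in>\<Theta>\<^sub>0. L-lipschitz_on UNIV (grad (\<lambda>\<zeta>. l \<zeta> v))"
  shows "twice_differentiable (\<lambda>x. loss T f \<Phi> l x \<theta>)"
    and "\<exists>X P \<beta> \<alpha>. adjoint_system T f \<Phi> l \<mu>\<^sub>0 p q \<delta> \<theta> X P \<beta> \<alpha>"
    and "\<And>X P \<beta> \<alpha>. adjoint_system T f \<Phi> l \<mu>\<^sub>0 p q \<delta> \<theta> X P \<beta> \<alpha> \<Longrightarrow>
      adjoint_objective T \<Phi> l \<mu>\<^sub>0 p q \<delta> \<theta> X P \<alpha> = robust_objective T f \<Phi> l \<mu>\<^sub>0 p q \<delta> \<theta>"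
proof -
  let ?S = "\<lambda>t \<xi> \<pi>. D2_transpose (\<lambda>\<zeta>. f \<zeta> (\<theta> t)) \<xi> \<pi> - hess (\<lambda>\<zeta>. \<Phi> \<zeta> (\<theta> t)) \<xi>"
  let ?j = "\<lambda>x. loss T f \<Phi> l x \<theta>"
  obtain M K L where "controlled_flow T M K L (\<lambda>t \<xi>. f \<xi> (\<theta> t)) (\<lambda>t \<xi>. jacobian (\<lambda>\<zeta>. f \<zeta> (\<theta> t)) (at \<xi>))
    (\<lambda>t \<xi>. \<Phi> \<xi> (\<theta> t)) (\<lambda>t \<xi>. grad (\<lambda>\<zeta>. \<Phi> \<zeta> (\<theta> t)) \<xi>) ?S
    (\<lambda>\<xi>. l \<xi> (\<theta> T)) (grad (\<lambda>\<zeta>. l \<zeta> (\<theta> T))) (hess (\<lambda>\<zeta>. l \<zeta> (\<theta> T)))"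
    using controlled_flow_of_control[OF T \<theta> f_bounded f_cont f_C2 \<Phi>_C2 l_C2 f_Lip \<Phi>_Lip l_Lip] by blast
  then interpret cf: controlled_flow T M K L "\<lambda>t \<xi>. f \<xi> (\<theta> t)" "\<lambda>t \<xi>. jacobian (\<lambda>\<zeta>. f \<zeta> (\<theta> t)) (at \<xi>)"
    "\<lambda>t \<xi>. \<Phi> \<xi> (\<theta> t)" "\<lambda>t \<xi>. grad (\<lambda>\<zeta>. \<Phi> \<zeta> (\<theta> t)) \<xi>" ?S
    "\<lambda>\<xi>. l \<xi> (\<theta> T)" "grad (\<lambda>\<zeta>. l \<zeta> (\<theta> T))" "hess (\<lambda>\<zeta>. l \<zeta> (\<theta> T))" .
  have T0: "0 \<in> {0..T}" "T \<in> {0..T}" using T by auto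
  have \<theta>_in: "\<theta> t \<in> \<Theta>\<^sub>0" if "t \<in> {0..T}" for t using \<theta> that by (auto simp: admissible_control_def)
  have traj: "trajectory T f \<theta> x = cf.flow x" for x
    by (simp add: trajectory_def cf.flow_def cf.is_state_def solves_ode_iff_primitive)
  have loss_eq: "?j = cf.total_cost"
    by (simp add: fun_eq_iff loss_def cf.total_cost_def traj)
  have grad_j: "grad ?j x = - cf.costate x 0" for x
    unfolding loss_eq by (rule grad_eqI[OF cf.total_cost_has_derivative])
  have "((\<lambda>x. - cf.costate x 0) has_derivative (\<lambda>h. cf.second x h 0)) (at x)" for x
    using has_derivative_minus[OF cf.costate_has_derivative[of x]] by simp
  then have grad_deriv: "(grad ?j has_derivative (\<lambda>h. cf.second x h 0)) (at x)" for x
    using grad_j by presburger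
  then have diff2: "grad ?j differentiable (at x)" for x by (auto simp: differentiable_def)
  have hess_j: "hess ?j x *v h = cf.second x h 0" for x h
    using has_derivative_unique[OF has_derivative_hess[OF diff2] grad_deriv, of x] by metis
  show "twice_differentiable ?j"
    unfolding twice_differentiable_def
    using diff2 cf.total_cost_has_derivative unfolding loss_eq by (auto simp: differentiable_def)
  have transpose_S: "transpose (?S t \<xi> \<pi>) = ?S t \<xi> \<pi>" if "t \<in> {0..T}" for t \<xi> \<pi>
  proof -
    have "transpose (C - D) = transpose C - transpose D" for C D :: "real^'d^'d"
      by (simp add: transpose_def vec_eq_iff)
    then show ?thesis
      using \<theta>_in[OF that] by (simp only: transpose_D2_transpose[OF f_C2] transpose_hess[OF \<Phi>_C2])
  qed
  \<comment> \<open>The normalising expectation couples all initial points, so the initial value of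
    \<beta> depends on the whole family \<open>P\<close>.\<close>
  define b where "b P x = (\<delta> * rpow (\<integral>x\<^sub>0. rpow (norm (P x\<^sub>0 0)) q \<partial>\<mu>\<^sub>0) (- real_of_ereal (1 / p))
      * rpow (norm (P x 0)) (q - 2)) *\<^sub>R P x 0" for P :: "real^'d \<Rightarrow> real \<Rightarrow> real^'d" and x
  have second_iff: "(solves_ode T
          (\<lambda>t y. - (transpose (jacobian (\<lambda>\<xi>. f \<xi> (\<theta> t)) (at (X t))) *v y)
                 + transpose (?S t (X t) (P t)) *v B t) \<alpha> \<and>
        \<alpha> T = transpose (hess (\<lambda>\<xi>. l \<xi> (\<theta> T)) (X T)) *v B T) \<longleftrightarrow> cf.is_second X P B \<alpha>" for X P B \<alpha>
  proof -
    \<comment> \<open>Symmetry is available only at times in \<open>{0..T}\<close>, where the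
      control value lies in \<open>\<Theta>\<^sub>0\<close>, so the densities are exchanged on that
      interval instead of being rewritten.\<close>
    have "primitive_on T (\<lambda>t. v t + transpose (?S t (X t) (P t)) *v B t) \<alpha>
        \<longleftrightarrow> primitive_on T (\<lambda>t. v t + ?S t (X t) (P t) *v B t) \<alpha>" for v
      by (rule iffI; erule primitive_on_cong) (use T in \<open>simp_all only: transpose_S less_imp_le\<close>)
    note iff = this
    show ?thesis
      unfolding solves_ode_iff_primitive cf.is_second_def iff transpose_hess[OF l_C2[OF \<theta>_in[OF T0(2)]]]
      ..
  qed
  have system_iff: "adjoint_system T f \<Phi> l \<mu>\<^sub>0 p q \<delta> \<theta> X P \<beta> \<alpha> \<longleftrightarrow>
      (\<forall>x. cf.is_state x (X x) \<and> cf.is_costate (X x) (P x) \<and> cf.is_tangent (X x) (b P x) (\<beta> x) \<and>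
        cf.is_second (X x) (P x) (\<beta> x) (\<alpha> x))" for X P \<beta> \<alpha>
    unfolding adjoint_system_def second_iff
    by (simp add: cf.is_state_def cf.is_costate_def cf.is_tangent_def solves_ode_iff_primitive b_def)
  have "adjoint_system T f \<Phi> l \<mu>\<^sub>0 p q \<delta> \<theta> cf.flow cf.costate
      (\<lambda>x. cf.tangent x (b cf.costate x)) (\<lambda>x. cf.second x (b cf.costate x))"
    unfolding system_iff using cf.flow cf.costate cf.tangent cf.second by blast
  then show "\<exists>X P \<beta> \<alpha>. adjoint_system T f \<Phi> l \<mu>\<^sub>0 p q \<delta> \<theta> X P \<beta> \<alpha>" by blast
  fix X P \<beta> \<alpha> assume sys: "adjoint_system T f \<Phi> l \<mu>\<^sub>0 p q \<delta> \<theta> X P \<beta> \<alpha>"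
  have X: "X x t = cf.flow x t" if "t \<in> {0..T}" for x t
    using cf.state_unique[OF _ cf.flow that] sys unfolding system_iff by blast
  have P: "P x t = cf.costate x t" if "t \<in> {0..T}" for x t
    using cf.costate_unique[OF X _ cf.costate that] sys unfolding system_iff by blast
  have \<beta>: "\<beta> x t = cf.tangent x (b P x) t" if "t \<in> {0..T}" for x t
    using cf.tangent_unique[OF X _ cf.tangent that] sys unfolding system_iff by blast
  have "\<alpha> x t = cf.second x (b P x) t" if "t \<in> {0..T}" for x t
    using cf.second_unique[OF X P \<beta> _ cf.second that] sys unfolding system_iff by blast
  then have \<alpha>0: "\<alpha> x 0 = hess ?j x *v b P x" for x using T0 by (simp add: hess_j)
  have P0: "P x 0 = - grad ?j x" for x using P[OF T0(1)] by (simp add: grad_j)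
  define E where "E = (\<integral>x. rpow (norm (grad ?j x)) q \<partial>\<mu>\<^sub>0)"
  define e where "e = real_of_ereal (1 / p)"
  define I where "I = (\<integral>x. (grad ?j x \<bullet> (hess ?j x *v grad ?j x))
      / rpow (norm (grad ?j x)) (2 * (1 - real_of_ereal (1 / (p - 1)))) \<partial>\<mu>\<^sub>0)"
  note exps = conjugate_exponent_identities[OF p q]
  have b: "b P x = - ((\<delta> * rpow E (- e) * rpow (norm (grad ?j x)) (q - 2)) *\<^sub>R grad ?j x)" for x
    by (simp add: b_def E_def e_def P0)
  have integrand: "rpow (norm (P x 0)) (q - 2) * (\<alpha> x 0 \<bullet> P x 0)
      = (\<delta> * rpow E (- e)) * ((grad ?j x \<bullet> (hess ?j x *v grad ?j x))
          / rpow (norm (grad ?j x)) (2 * (1 - real_of_ereal (1 / (p - 1)))))" for x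
  proof -
    let ?G = "grad ?j x" and ?r = "rpow (norm (grad ?j x)) (q - 2)"
    \<comment> \<open>The minus sign in the initial value of \<alpha>, inherited from
      \<open>b\<close>, cancels the one in P = - grad j.\<close>
    have "\<alpha> x 0 \<bullet> P x 0 = (\<delta> * rpow E (- e) * ?r) * (?G \<bullet> (hess ?j x *v ?G))"
      unfolding \<alpha>0 P0 b linear_neg[OF matrix_vector_mul_linear] matrix_vector_mult_scaleR
      by (simp add: inner_commute)
    then have "?r * (\<alpha> x 0 \<bullet> P x 0) = (\<delta> * rpow E (- e)) * (?G \<bullet> (hess ?j x *v ?G)) * (?r * ?r)"
      by (simp add: mult_ac)
    moreover have "norm (P x 0) = norm ?G" by (simp add: P0)
    ultimately show ?thesis unfolding rpow_square exps(2) by simp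
  qed
  \<comment> \<open>A constant factor leaves the Bochner integral also for a non-integrable
    integrand, where both sides are 0.\<close>
  have "(\<integral>x. rpow (norm (P x 0)) (q - 2) * (\<alpha> x 0 \<bullet> P x 0) \<partial>\<mu>\<^sub>0) = (\<delta> * rpow E (- e)) * I"
    unfolding integrand I_def by (rule integral_mult_right_zero)
  moreover have "(\<integral>x. rpow (norm (P x 0)) q \<partial>\<mu>\<^sub>0) = E" by (simp add: P0 E_def)
  moreover have "l (X x T) (\<theta> T) + integral {0..T} (\<lambda>t. \<Phi> (X x t) (\<theta> t)) = ?j x" for x
  proof -
    have "integral {0..T} (\<lambda>t. \<Phi> (X x t) (\<theta> t)) = integral {0..T} (\<lambda>t. \<Phi> (cf.flow x t) (\<theta> t))"
      by (rule Henstock_Kurzweil_Integration.integral_cong) (simp add: X)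
    then show ?thesis unfolding loss_def traj X[OF T0(2)] by simp
  qed
  ultimately have "adjoint_objective T \<Phi> l \<mu>\<^sub>0 p q \<delta> \<theta> X P \<alpha>
      = (\<integral>x. ?j x \<partial>\<mu>\<^sub>0) + \<delta> * rpow E (1 / q) + \<delta> / 2 * (((\<delta> * rpow E (- e)) * I) / rpow E e)"
    by (simp add: adjoint_objective_def e_def)
  also have "\<dots> = (\<integral>x. ?j x \<partial>\<mu>\<^sub>0) + \<delta> * rpow E (1 / q) + \<delta>\<^sup>2 / 2 * rpow E (- (2 * e)) * I"
    by (simp add: rpow_neg_double power2_eq_square)
  also have "\<dots> = robust_objective T f \<Phi> l \<mu>\<^sub>0 p q \<delta> \<theta>"
    by (simp only: robust_objective_def expected_loss_def Let_def exps(1) I_def E_def e_def)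
  finally show "adjoint_objective T \<Phi> l \<mu>\<^sub>0 p q \<delta> \<theta> X P \<alpha> = robust_objective T f \<Phi> l \<mu>\<^sub>0 p q \<delta> \<theta>" .
qed

theorem proposition1p16:
  fixes T \<delta> q :: real
    and p :: ereal
    and \<Theta>\<^sub>0 :: "'c::real_normed_vector set"
    and \<Theta> :: "(real \<Rightarrow> 'c) set"
    and f :: "real^'d \<Rightarrow> 'c \<Rightarrow> real^'d"
    and \<Phi> l :: "real^'d \<Rightarrow> 'c \<Rightarrow> real"
    and \<mu>\<^sub>0 :: "(real^'d) measure"
  assumes T: "T > 0"
    and \<delta>: "\<delta> > 0"
    and p: "2 \<le> p"
    and q: "1 / p + 1 / ereal q = 1"
    and controls: "\<And>\<theta>. \<theta> \<in> \<Theta> \<Longrightarrow> admissible_control T \<Theta>\<^sub>0 \<Phi> \<theta>"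
    and f_bounded: "\<exists>M. \<forall>\<xi>. \<forall>v\<in>\<Theta>\<^sub>0. norm (f \<xi> v) \<le> M"
    and f_cont: "\<And>\<xi>. continuous_on \<Theta>\<^sub>0 (f \<xi>)"
    and \<Phi>_cont: "\<And>\<xi>. continuous_on \<Theta>\<^sub>0 (\<Phi> \<xi>)"
    and f_C2: "\<And>v k. v \<in> \<Theta>\<^sub>0 \<Longrightarrow> C2 (\<lambda>\<xi>. f \<xi> v $ k)"
    and \<Phi>_C2: "\<And>v. v \<in> \<Theta>\<^sub>0 \<Longrightarrow> C2 (\<lambda>\<xi>. \<Phi> \<xi> v)"
    and l_C2: "\<And>v. v \<in> \<Theta>\<^sub>0 \<Longrightarrow> C2 (\<lambda>\<xi>. l \<xi> v)"
    and f_Lip: "\<exists>L. \<forall>v\<in>\<Theta>\<^sub>0. L-lipschitz_on UNIV (\<lambda>\<xi>. jacobian (\<lambda>\<zeta>. f \<zeta> v) (at \<xi>))"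
    and \<Phi>_Lip: "\<exists>L. \<forall>v\<in>\<Theta>\<^sub>0. L-lipschitz_on UNIV (grad (\<lambda>\<zeta>. \<Phi> \<zeta> v))"
    and l_Lip: "\<exists>L. \<forall>v\<in>\<Theta>\<^sub>0. L-lipschitz_on UNIV (grad (\<lambda>\<zeta>. l \<zeta> v))"
    and l_C1: "\<And>\<xi>. continuously_differentiable_on (l \<xi>) \<Theta>\<^sub>0"
    and \<mu>\<^sub>0_prob: "prob_space \<mu>\<^sub>0"
    and \<mu>\<^sub>0_borel: "sets \<mu>\<^sub>0 = sets borel"
    and \<mu>\<^sub>0_bounded: "bounded (measure_support \<mu>\<^sub>0)"
  shows "(\<forall>\<theta>\<in>\<Theta>. twice_differentiable (\<lambda>x. loss T f \<Phi> l x \<theta>))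
       \<and> (\<forall>\<theta>\<in>\<Theta>. \<exists>X P \<beta> \<alpha>. adjoint_system T f \<Phi> l \<mu>\<^sub>0 p q \<delta> \<theta> X P \<beta> \<alpha>)
       \<and> (\<forall>\<theta>\<in>\<Theta>. \<forall>X P \<beta> \<alpha>. adjoint_system T f \<Phi> l \<mu>\<^sub>0 p q \<delta> \<theta> X P \<beta> \<alpha> \<longrightarrow>
            adjoint_objective T \<Phi> l \<mu>\<^sub>0 p q \<delta> \<theta> X P \<alpha> = robust_objective T f \<Phi> l \<mu>\<^sub>0 p q \<delta> \<theta>)
       \<and> (INF \<theta>\<in>\<Theta>. ereal (robust_objective T f \<Phi> l \<mu>\<^sub>0 p q \<delta> \<theta>))
         = (INF (\<theta>, X, P, \<beta>, \<alpha>)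
              \<in> {(\<theta>, X, P, \<beta>, \<alpha>). \<theta> \<in> \<Theta> \<and> adjoint_system T f \<Phi> l \<mu>\<^sub>0 p q \<delta> \<theta> X P \<beta> \<alpha>}.
              ereal (adjoint_objective T \<Phi> l \<mu>\<^sub>0 p q \<delta> \<theta> X P \<alpha>))
       \<and> (\<forall>\<theta> X P \<beta> \<alpha>. \<theta> \<in> \<Theta> \<and> adjoint_system T f \<Phi> l \<mu>\<^sub>0 p q \<delta> \<theta> X P \<beta> \<alpha> \<longrightarrow>
            is_arg_min (robust_objective T f \<Phi> l \<mu>\<^sub>0 p q \<delta>) (\<lambda>\<theta>. \<theta> \<in> \<Theta>) \<theta>
            \<longleftrightarrow> is_arg_min (\<lambda>(\<theta>, X, P, \<beta>, \<alpha>). adjoint_objective T \<Phi> l \<mu>\<^sub>0 p q \<delta> \<theta> X P \<alpha>)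
                  (\<lambda>(\<theta>, X, P, \<beta>, \<alpha>). \<theta> \<in> \<Theta> \<and> adjoint_system T f \<Phi> l \<mu>\<^sub>0 p q \<delta> \<theta> X P \<beta> \<alpha>)
                  (\<theta>, X, P, \<beta>, \<alpha>))"
proof -
  let ?sys = "adjoint_system T f \<Phi> l \<mu>\<^sub>0 p q \<delta>" and ?R = "robust_objective T f \<Phi> l \<mu>\<^sub>0 p q \<delta>"
    and ?A = "adjoint_objective T \<Phi> l \<mu>\<^sub>0 p q \<delta>"
  note reform = adjoint_reformulation[OF T p q controls f_bounded f_cont f_C2 \<Phi>_C2 l_C2 f_Lip \<Phi>_Lip l_Lip]
  have diff: "twice_differentiable (\<lambda>x. loss T f \<Phi> l x \<theta>)" if "\<theta> \<in> \<Theta>" for \<theta>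
    using that by (rule reform(1))
  have ex: "\<exists>X P \<beta> \<alpha>. ?sys \<theta> X P \<beta> \<alpha>" if "\<theta> \<in> \<Theta>" for \<theta>
    using that by (rule reform(2))
  have eq: "?A \<theta> X P \<alpha> = ?R \<theta>" if "\<theta> \<in> \<Theta>" "?sys \<theta> X P \<beta> \<alpha>" for \<theta> X P \<beta> \<alpha>
    using reform(3) that by blast
  \<comment> \<open>The fibre of the constraint set over each control is nonempty, and the adjoint
    objective is constant on it with the robust value; this settles the infima here and the
    minimisers below.\<close>
  have "(INF \<theta>\<in>\<Theta>. ereal (?R \<theta>))
      = (INF (\<theta>, X, P, \<beta>, \<alpha>) \<in> {(\<theta>, X, P, \<beta>, \<alpha>). \<theta> \<in> \<Theta> \<and> ?sys \<theta> X P \<beta> \<alpha>}. ereal (?A \<theta> X P \<alpha>))"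
  proof (rule INF_eq)
    fix \<theta> assume \<theta>: "\<theta> \<in> \<Theta>"
    obtain X P \<beta> \<alpha> where "?sys \<theta> X P \<beta> \<alpha>" using ex[OF \<theta>] by blast
    with \<theta> eq[OF \<theta> this] show "\<exists>z\<in>{(\<theta>, X, P, \<beta>, \<alpha>). \<theta> \<in> \<Theta> \<and> ?sys \<theta> X P \<beta> \<alpha>}.
        (case z of (\<theta>, X, P, \<beta>, \<alpha>) \<Rightarrow> ereal (?A \<theta> X P \<alpha>)) \<le> ereal (?R \<theta>)"
      by (intro bexI[of _ "(\<theta>, X, P, \<beta>, \<alpha>)"]) auto
  next
    fix z assume "z \<in> {(\<theta>, X, P, \<beta>, \<alpha>). \<theta> \<in> \<Theta> \<and> ?sys \<theta> X P \<beta> \<alpha>}"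
    then show "\<exists>\<theta>\<in>\<Theta>. ereal (?R \<theta>) \<le> (case z of (\<theta>, X, P, \<beta>, \<alpha>) \<Rightarrow> ereal (?A \<theta> X P \<alpha>))"
      using eq by (fastforce split: prod.splits)
  qed
  moreover have "is_arg_min ?R (\<lambda>\<theta>. \<theta> \<in> \<Theta>) \<theta>
      \<longleftrightarrow> is_arg_min (\<lambda>(\<theta>, X, P, \<beta>, \<alpha>). ?A \<theta> X P \<alpha>) (\<lambda>(\<theta>, X, P, \<beta>, \<alpha>). \<theta> \<in> \<Theta> \<and> ?sys \<theta> X P \<beta> \<alpha>)
            (\<theta>, X, P, \<beta>, \<alpha>)" if \<theta>: "\<theta> \<in> \<Theta>" "?sys \<theta> X P \<beta> \<alpha>" for \<theta> X P \<beta> \<alpha>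
  proof -
    have "(\<exists>\<theta>'\<in>\<Theta>. ?R \<theta>' < ?R \<theta>) \<longleftrightarrow>
        (\<exists>\<theta>' X' P' \<beta>' \<alpha>'. \<theta>' \<in> \<Theta> \<and> ?sys \<theta>' X' P' \<beta>' \<alpha>' \<and> ?A \<theta>' X' P' \<alpha>' < ?R \<theta>)"
      using ex eq by (metis (no_types))
    then show ?thesis using \<theta> by (auto simp: is_arg_min_def eq[OF \<theta>])
  qed
  ultimately show ?thesis using diff ex eq by blast
qed

end
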